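(* There is an absolute constant $C>0$ such that the following holds. Let $A$ be an $m\times n$ integer matrix with $\|A\|_{\gamma_2}\le \gamma$, and let $k=\min\{m,n\}$, where $k\ge 2$. Then $$\operatorname{block}(A)\le 2^{C\gamma^7}(\log k)^2 ,$$ where $\log$ is the natural logarithm.
   Context: A boolean matrix $B\in\{0,1\}^{X\times Y}$ (with $X,Y$ finite index sets) is called blocky if there exist families $\{S_i\}$ of pairwise disjoint subsets of $X$ and $\{T_i\}$ of pairwise disjoint subsets of $Y$ such that the support $\{(x,y): B(x,y)=1\}$ equals $\bigcup_i S_i\times T_i$ (in particular the zero matrix is blocky). The block complexity $\operatorname{block}(A)$ of an integer matrix $A$ is the smallest integer $L\ge 0$ such that $A=\sum_{i=1}^L \sigma_i B_i$ for some blocky matrices $B_i$ of the same shape and signs $\sigma_i\in\{-1,1\}$. The $\gamma_2$ factorization norm of a matrix $A$ is $\|A\|_{\gamma_2}=\min_{UV=A}\|U\|_{\mathrm{row}}\|V\|_{\mathrm{col}}$, where the minimum is over all factorizations $A=UV$ (with an arbitrary inner dimension), $\|U\|_{\mathrm{row}}$ is the largest Euclidean norm of a row of $U$ and $\|V\|_{\mathrm{col}}$ is the largest Euclidean norm of a column of $V$. (By Grothendieck's theorem this equals the Schur multiplier norm of $A$.) *)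

theory Defs
  imports Complex_Main
begin

text \<open>An m x n matrix is represented as a function nat => nat => 'a, of which only the
entries with row index < m and column index < n matter (X = {..<m}, Y = {..<n}).\<close>

definition blocky :: "nat \<Rightarrow> nat \<Rightarrow> (nat \<Rightarrow> nat \<Rightarrow> int) \<Rightarrow> bool" where
  "blocky m n B \<longleftrightarrow>
     (\<forall>x<m. \<forall>y<n. B x y \<in> {0, 1}) \<and>
     (\<exists>(I :: nat set) (S :: nat \<Rightarrow> nat set) (T :: nat \<Rightarrow> nat set).
        (\<forall>i\<in>I. S i \<subseteq> {..<m} \<and> T i \<subseteq> {..<n}) \<and>
        (\<forall>i\<in>I. \<forall>j\<in>I. i \<noteq> j \<longrightarrow> S i \<inter> S j = {} \<and> T i \<inter> T j = {}) \<and>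
        {(x, y). x < m \<and> y < n \<and> B x y = 1} = (\<Union>i\<in>I. S i \<times> T i))"

definition block :: "nat \<Rightarrow> nat \<Rightarrow> (nat \<Rightarrow> nat \<Rightarrow> int) \<Rightarrow> nat" where
  "block m n A = (LEAST L. \<exists>(B :: nat \<Rightarrow> nat \<Rightarrow> nat \<Rightarrow> int) (\<sigma> :: nat \<Rightarrow> int).
       (\<forall>i<L. blocky m n (B i) \<and> \<sigma> i \<in> {-1, 1}) \<and>
       (\<forall>x<m. \<forall>y<n. A x y = (\<Sum>i<L. \<sigma> i * B i x y)))"

definition row_norm :: "nat \<Rightarrow> nat \<Rightarrow> (nat \<Rightarrow> nat \<Rightarrow> real) \<Rightarrow> real" where
  "row_norm m d U = Max ((\<lambda>x. sqrt (\<Sum>k<d. (U x k)\<^sup>2)) ` {..<m})"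

definition col_norm :: "nat \<Rightarrow> nat \<Rightarrow> (nat \<Rightarrow> nat \<Rightarrow> real) \<Rightarrow> real" where
  "col_norm d n V = Max ((\<lambda>y. sqrt (\<Sum>k<d. (V k y)\<^sup>2)) ` {..<n})"

definition gamma2 :: "nat \<Rightarrow> nat \<Rightarrow> (nat \<Rightarrow> nat \<Rightarrow> int) \<Rightarrow> real" where
  "gamma2 m n A = Inf {r. \<exists>(d :: nat) (U :: nat \<Rightarrow> nat \<Rightarrow> real) (V :: nat \<Rightarrow> nat \<Rightarrow> real).
       (\<forall>x<m. \<forall>y<n. real_of_int (A x y) = (\<Sum>k<d. U x k * V k y)) \<and>
       r = row_norm m d U * col_norm d n V}"

end

theory Submission
  imports Defs "HOL-Analysis.Convex"
begin

text \<open>Write \<open>A x y = \<langle>u x, v y\<rangle>\<close> with \<open>\<parallel>u x\<parallel> \<le> G\<close>, \<open>\<parallel>v y\<parallel> \<le> 1\<close> and \<open>G = O(\<gamma>)\<close>, the rows being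
  the shorter side.  Every set of rows with a common nonzero column contains an \<open>exp (- O(G^4))\<close>
  fraction \<open>R\<close> on which each column is constant outside an \<open>exp (- \<Omega>(G^2))\<close> fraction; the mean \<open>w\<close>
  of the vectors in \<open>R\<close> then has almost integral products with all \<open>v y\<close> and norm at least \<open>3/4\<close>,
  so subtracting \<open>w\<close> from the rows (and its rounding from \<open>A\<close>) lowers the squared norm of many rows
  by \<open>1/4\<close> and keeps the matrix integral and approximately factorised.  If the row sets are supports
  of columns chosen greedily by size, each column meets only \<open>exp (O(G^4)) log k\<close> of the clusters,
  and the subtracted matrix is a sum of that many blocky matrices up to a factor \<open>O(G)\<close>.  The norms are exhausted
  after \<open>O(G^2)\<close> rounds, although the rounding error doubles in each of them; this decomposes \<open>A\<close> on
  an \<open>exp (- O(G^6))\<close> fraction of any set of rows, and \<open>exp (O(G^6)) log k\<close> such sets exhaust all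
  rows.\<close>

section \<open>Signed sums of blocky matrices\<close>

text \<open>The condition under the \<open>LEAST\<close> in \<open>block\<close>, kept as a
  predicate so that lengths of decompositions can be added and any single decomposition bounds
  \<open>block\<close> from above.\<close>

definition signed_blocky_sum :: "nat \<Rightarrow> nat \<Rightarrow> nat \<Rightarrow> (nat \<Rightarrow> nat \<Rightarrow> int) \<Rightarrow> bool" where
  "signed_blocky_sum m n L A \<longleftrightarrow>
     (\<exists>(B :: nat \<Rightarrow> nat \<Rightarrow> nat \<Rightarrow> int) (\<sigma> :: nat \<Rightarrow> int).
       (\<forall>i<L. blocky m n (B i) \<and> \<sigma> i \<in> {-1, 1}) \<and>
       (\<forall>x<m. \<forall>y<n. A x y = (\<Sum>i<L. \<sigma> i * B i x y)))"

text \<open>Rows outside \<open>S\<close> are set to zero rather than deleted: the shape stays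
  \<open>m\<close> by \<open>n\<close>, so decompositions on disjoint row sets can simply be
  added.\<close>

definition restrict_rows :: "nat set \<Rightarrow> (nat \<Rightarrow> nat \<Rightarrow> int) \<Rightarrow> nat \<Rightarrow> nat \<Rightarrow> int" where
  "restrict_rows S A = (\<lambda>x y. if x \<in> S then A x y else 0)"

lemma block_le:
  assumes "signed_blocky_sum m n L A"
  shows "block m n A \<le> L"
  using assms unfolding block_def signed_blocky_sum_def by (rule Least_le)

text \<open>Blockiness through an entrywise formula instead of an equation of supports. With the
  converse \<open>blockyE\<close>, transposition and row restriction become rewriting.\<close>

lemma blockyI:
  fixes I :: "nat set"
  assumes "\<And>i. i \<in> I \<Longrightarrow> S i \<subseteq> {..<m}" "\<And>i. i \<in> I \<Longrightarrow> T i \<subseteq> {..<n}"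
    and "\<And>i j. i \<in> I \<Longrightarrow> j \<in> I \<Longrightarrow> i \<noteq> j \<Longrightarrow> S i \<inter> S j = {}"
    and "\<And>i j. i \<in> I \<Longrightarrow> j \<in> I \<Longrightarrow> i \<noteq> j \<Longrightarrow> T i \<inter> T j = {}"
    and "\<And>x y. x < m \<Longrightarrow> y < n \<Longrightarrow> B x y = (if \<exists>i\<in>I. x \<in> S i \<and> y \<in> T i then 1 else 0)"
  shows "blocky m n B"
  unfolding blocky_def
proof (rule conjI, use assms(5) in simp, rule exI[of _ I], rule exI[of _ S], rule exI[of _ T],
    intro conjI)
  show "{(x, y). x < m \<and> y < n \<and> B x y = 1} = (\<Union>i\<in>I. S i \<times> T i)"
  proof (intro equalityI subsetI)
    fix p assume "p \<in> {(x, y). x < m \<and> y < n \<and> B x y = 1}"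
    then show "p \<in> (\<Union>i\<in>I. S i \<times> T i)" using assms(5) by (auto split: if_splits)
  next
    fix p assume "p \<in> (\<Union>i\<in>I. S i \<times> T i)"
    then obtain i x y where p: "p = (x, y)" and i: "i \<in> I" "x \<in> S i" "y \<in> T i" by auto
    then have "x < m" "y < n" using assms(1,2)[OF i(1)] by auto
    then show "p \<in> {(x, y). x < m \<and> y < n \<and> B x y = 1}" using assms(5)[of x y] p i by auto
  qed
qed (use assms in auto)

lemma blocky_zero: "blocky m n (\<lambda>_ _. 0)"
  by (rule blockyI[where I = "{}"]) auto

lemma blockyE:
  assumes "blocky m n B"
  obtains I :: "nat set" and S T where
    "\<And>i. i \<in> I \<Longrightarrow> S i \<subseteq> {..<m}" "\<And>i. i \<in> I \<Longrightarrow> T i \<subseteq> {..<n}"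
    "\<And>i j. i \<in> I \<Longrightarrow> j \<in> I \<Longrightarrow> i \<noteq> j \<Longrightarrow> S i \<inter> S j = {}"
    "\<And>i j. i \<in> I \<Longrightarrow> j \<in> I \<Longrightarrow> i \<noteq> j \<Longrightarrow> T i \<inter> T j = {}"
    "\<And>x y. x < m \<Longrightarrow> y < n \<Longrightarrow> B x y = (if \<exists>i\<in>I. x \<in> S i \<and> y \<in> T i then 1 else 0)"
proof -
  obtain I :: "nat set" and S T where IST: "\<forall>i\<in>I. S i \<subseteq> {..<m} \<and> T i \<subseteq> {..<n}"
    "\<forall>i\<in>I. \<forall>j\<in>I. i \<noteq> j \<longrightarrow> S i \<inter> S j = {} \<and> T i \<inter> T j = {}"
    "{(x, y). x < m \<and> y < n \<and> B x y = 1} = (\<Union>i\<in>I. S i \<times> T i)"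
    and B01: "\<forall>x<m. \<forall>y<n. B x y \<in> {0, 1}"
    using assms unfolding blocky_def by (elim conjE exE) (rule that; assumption)
  have B: "B x y = (if \<exists>i\<in>I. x \<in> S i \<and> y \<in> T i then 1 else 0)" if "x < m" "y < n" for x y
  proof -
    have "(x, y) \<in> {(x, y). x < m \<and> y < n \<and> B x y = 1} \<longleftrightarrow> (\<exists>i\<in>I. x \<in> S i \<and> y \<in> T i)"
      unfolding IST(3) by blast
    moreover have "B x y = 0 \<or> B x y = 1" using B01 that by blast
    ultimately show ?thesis using that by auto
  qed
  show ?thesis
  proof (rule that[of I S T])
    fix i j assume "i \<in> I" "j \<in> I" "i \<noteq> j"
    with IST(2) show "S i \<inter> S j = {}" "T i \<inter> T j = {}" by simp_all
  qed (use IST(1) B in simp_all)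
qed

lemma blocky_transpose:
  assumes "blocky m n B"
  shows "blocky n m (\<lambda>x y. B y x)"
  using assms
proof (rule blockyE)
  fix I :: "nat set" and S T
  assume IST: "\<And>i. i \<in> I \<Longrightarrow> S i \<subseteq> {..<m}" "\<And>i. i \<in> I \<Longrightarrow> T i \<subseteq> {..<n}"
    "\<And>i j. i \<in> I \<Longrightarrow> j \<in> I \<Longrightarrow> i \<noteq> j \<Longrightarrow> S i \<inter> S j = {}"
    "\<And>i j. i \<in> I \<Longrightarrow> j \<in> I \<Longrightarrow> i \<noteq> j \<Longrightarrow> T i \<inter> T j = {}"
    "\<And>x y. x < m \<Longrightarrow> y < n \<Longrightarrow> B x y = (if \<exists>i\<in>I. x \<in> S i \<and> y \<in> T i then 1 else 0)"
  show ?thesis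
    by (rule blockyI[of I T n S m, OF IST(2,1,4,3)]) (simp_all add: IST(5) conj_commute)
qed

lemma blocky_restrict_rows:
  assumes "blocky m n B"
  shows "blocky m n (restrict_rows R B)"
  using assms
proof (rule blockyE)
  fix I :: "nat set" and S T
  assume IST: "\<And>i. i \<in> I \<Longrightarrow> S i \<subseteq> {..<m}" "\<And>i. i \<in> I \<Longrightarrow> T i \<subseteq> {..<n}"
    "\<And>i j. i \<in> I \<Longrightarrow> j \<in> I \<Longrightarrow> i \<noteq> j \<Longrightarrow> S i \<inter> S j = {}"
    "\<And>i j. i \<in> I \<Longrightarrow> j \<in> I \<Longrightarrow> i \<noteq> j \<Longrightarrow> T i \<inter> T j = {}"
    "\<And>x y. x < m \<Longrightarrow> y < n \<Longrightarrow> B x y = (if \<exists>i\<in>I. x \<in> S i \<and> y \<in> T i then 1 else 0)"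
  show ?thesis
  proof (rule blockyI[where I = I and S = "\<lambda>i. S i \<inter> R" and T = T])
    fix i j assume "i \<in> I" "j \<in> I" "i \<noteq> j"
    from IST(3)[OF this] show "S i \<inter> R \<inter> (S j \<inter> R) = {}" by blast
  next
    fix i assume "i \<in> I"
    from IST(1)[OF this] show "S i \<inter> R \<subseteq> {..<m}" by blast
  qed (simp_all add: IST(2,4,5) restrict_rows_def)
qed

lemma signed_blocky_sum_cong:
  assumes "signed_blocky_sum m n L A" "\<And>x y. x < m \<Longrightarrow> y < n \<Longrightarrow> A' x y = A x y"
  shows "signed_blocky_sum m n L A'"
  using assms unfolding signed_blocky_sum_def by simp

text \<open>Any number \<open>L\<close> of zero matrices may be used, so a recursion that stops
  early still has the length promised for the full number of rounds.\<close>

lemma signed_blocky_sum_zero: "signed_blocky_sum m n L (\<lambda>_ _. 0)"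
  unfolding signed_blocky_sum_def
  by (rule exI[of _ "\<lambda>_ _ _. 0"], rule exI[of _ "\<lambda>_. 1"]) (simp add: blocky_zero)

lemma signed_blocky_sum_blocky:
  assumes "blocky m n B"
  shows "signed_blocky_sum m n 1 B" "signed_blocky_sum m n 1 (\<lambda>x y. - B x y)"
proof -
  show "signed_blocky_sum m n 1 B"
    unfolding signed_blocky_sum_def
    by (rule exI[of _ "\<lambda>_. B"], rule exI[of _ "\<lambda>_. 1"]) (simp add: assms)
  show "signed_blocky_sum m n 1 (\<lambda>x y. - B x y)"
    unfolding signed_blocky_sum_def
    by (rule exI[of _ "\<lambda>_. B"], rule exI[of _ "\<lambda>_. -1"]) (simp add: assms)
qed

lemma signed_blocky_sum_add:
  assumes "signed_blocky_sum m n L A" "signed_blocky_sum m n L' A'"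
  shows "signed_blocky_sum m n (L + L') (\<lambda>x y. A x y + A' x y)"
proof -
  obtain B \<sigma> where B: "\<forall>i<L. blocky m n (B i) \<and> \<sigma> i \<in> {-1, 1}"
    "\<forall>x<m. \<forall>y<n. A x y = (\<Sum>i<L. \<sigma> i * B i x y)"
    using assms(1) unfolding signed_blocky_sum_def by blast
  obtain B' \<sigma>' where B': "\<forall>i<L'. blocky m n (B' i) \<and> \<sigma>' i \<in> {-1, 1}"
    "\<forall>x<m. \<forall>y<n. A' x y = (\<Sum>i<L'. \<sigma>' i * B' i x y)"
    using assms(2) unfolding signed_blocky_sum_def by blast
  define C where "C i = (if i < L then B i else B' (i - L))" for i
  define \<tau> where "\<tau> i = (if i < L then \<sigma> i else \<sigma>' (i - L))" for i
  have "(\<Sum>i<L + L'. \<tau> i * C i x y) = (\<Sum>i<L. \<sigma> i * B i x y) + (\<Sum>i<L'. \<sigma>' i * B' i x y)"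
    for x y
  proof -
    have "(\<Sum>i<L + L'. \<tau> i * C i x y) = (\<Sum>i<L. \<tau> i * C i x y) + (\<Sum>i<L'. \<tau> (L + i) * C (L + i) x y)"
      by (induction L') simp_all
    then show ?thesis by (simp add: C_def \<tau>_def)
  qed
  moreover have "blocky m n (C i) \<and> \<tau> i \<in> {-1, 1}" if "i < L + L'" for i
    using that B(1) B'(1) by (auto simp: C_def \<tau>_def)
  ultimately show ?thesis
    unfolding signed_blocky_sum_def using B(2) B'(2)
    by (intro exI[of _ C] exI[of _ \<tau>]) auto
qed

lemma signed_blocky_sum_sum:
  assumes "\<And>j. j < q \<Longrightarrow> signed_blocky_sum m n L (A j)"
  shows "signed_blocky_sum m n (q * L) (\<lambda>x y. \<Sum>j<(q::nat). A j x y)"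
  using assms
proof (induction q)
  case 0
  then show ?case by (simp add: signed_blocky_sum_zero)
next
  case (Suc q)
  from signed_blocky_sum_add[OF Suc.IH Suc.prems[of q]] Suc.prems show ?case
    by (simp add: add.commute)
qed

lemma signed_blocky_sum_transpose:
  assumes "signed_blocky_sum m n L A"
  shows "signed_blocky_sum n m L (\<lambda>x y. A y x)"
proof -
  obtain B \<sigma> where B: "\<forall>i<L. blocky m n (B i) \<and> \<sigma> i \<in> {-1, 1}"
    "\<forall>x<m. \<forall>y<n. A x y = (\<Sum>i<L. \<sigma> i * B i x y)"
    using assms unfolding signed_blocky_sum_def by blast
  then show ?thesis unfolding signed_blocky_sum_def
    by (intro exI[of _ "\<lambda>i x y. B i y x"] exI[of _ \<sigma>]) (auto intro: blocky_transpose)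
qed

lemma signed_blocky_sum_restrict_rows:
  assumes "signed_blocky_sum m n L A"
  shows "signed_blocky_sum m n L (restrict_rows R A)"
proof -
  obtain B \<sigma> where B: "\<forall>i<L. blocky m n (B i) \<and> \<sigma> i \<in> {-1, 1}"
    "\<forall>x<m. \<forall>y<n. A x y = (\<Sum>i<L. \<sigma> i * B i x y)"
    using assms unfolding signed_blocky_sum_def by blast
  then show ?thesis unfolding signed_blocky_sum_def
    by (intro exI[of _ "\<lambda>i. restrict_rows R (B i)"] exI[of _ \<sigma>])
       (auto intro: blocky_restrict_rows[unfolded restrict_rows_def] simp: restrict_rows_def)
qed

section \<open>Matrices with constant columns on disjoint row clusters\<close>

lemma sum_if_disjoint:
  fixes f :: "nat \<Rightarrow> 'a::comm_monoid_add"
  assumes "\<And>i j. i < N \<Longrightarrow> j < N \<Longrightarrow> i \<noteq> j \<Longrightarrow> D i \<inter> D j = {}" "i < N" "x \<in> D i"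
  shows "(\<Sum>j<N. if x \<in> D j then f j else 0) = f i"
proof -
  have "(if x \<in> D j then f j else 0) = 0" if "j \<in> {..<N} - {i}" for j
    using assms(1)[of i j] that assms(2,3) by auto
  then have "(\<Sum>j\<in>{..<N} - {i}. if x \<in> D j then f j else 0) = 0" by (intro sum.neutral) blast
  then show ?thesis using assms(2,3) by (simp add: sum.remove[of _ i])
qed

text \<open>For each column \<open>y\<close> the indices with \<open>z i y \<noteq> 0\<close> are numbered injectively by fewer than
  \<open>s\<close> colours; fixing a colour and a level \<open>t\<close> of \<open>\<bar>z i y\<bar>\<close> makes the column sets of
  different \<open>i\<close> disjoint.\<close>

lemma signed_blocky_sum_row_clusters:
  fixes D :: "nat \<Rightarrow> nat set" and z :: "nat \<Rightarrow> nat \<Rightarrow> int" and N s g :: nat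
  assumes D: "\<And>i. i < N \<Longrightarrow> D i \<subseteq> {..<m}"
    and disj: "\<And>i j. i < N \<Longrightarrow> j < N \<Longrightarrow> i \<noteq> j \<Longrightarrow> D i \<inter> D j = {}"
    and z: "\<And>i y. i < N \<Longrightarrow> y < n \<Longrightarrow> \<bar>z i y\<bar> \<le> int g"
    and s: "\<And>y. y < n \<Longrightarrow> card {i. i < N \<and> z i y \<noteq> 0} \<le> s"
  shows "signed_blocky_sum m n (s * (g * 2)) (\<lambda>x y. \<Sum>i<N. if x \<in> D i then z i y else 0)"
proof -
  have "\<forall>y\<in>{..<n}. \<exists>h. inj_on h {i. i < N \<and> z i y \<noteq> 0} \<and> h ` {i. i < N \<and> z i y \<noteq> 0} \<subseteq> {..<s}"
  proof
    fix y assume "y \<in> {..<n}"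
    then show "\<exists>h. inj_on h {i. i < N \<and> z i y \<noteq> 0} \<and> h ` {i. i < N \<and> z i y \<noteq> 0} \<subseteq> {..<s}"
      using card_le_inj[of "{i. i < N \<and> z i y \<noteq> 0}" "{..<s}"] s[of y] by auto
  qed
  from bchoice[OF this] obtain h :: "nat \<Rightarrow> nat \<Rightarrow> nat"
    where h: "\<And>y. y < n \<Longrightarrow> inj_on (h y) {i. i < N \<and> z i y \<noteq> 0}"
             "\<And>y. y < n \<Longrightarrow> h y ` {i. i < N \<and> z i y \<noteq> 0} \<subseteq> {..<s}"
    by auto
  \<comment> \<open>One summand per colour \<open>p\<close>, level \<open>t\<close> and sign
    \<open>\<sigma>\<close>. The condition \<open>int t < \<sigma> * z i y\<close> forces
    \<open>z i y \<noteq> 0\<close>, and there \<open>h y\<close> is injective.\<close>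
  define B :: "nat \<Rightarrow> nat \<Rightarrow> int \<Rightarrow> nat \<Rightarrow> nat \<Rightarrow> int" where
    "B p t \<sigma> x y = (\<Sum>i<N. if x \<in> D i \<and> h y i = p \<and> int t < \<sigma> * z i y then 1 else 0)" for p t \<sigma> x y
  have blB: "blocky m n (B p t \<sigma>)" for p t \<sigma>
  proof (rule blockyI[where I = "{..<N}" and S = D and
        T = "\<lambda>i. {y. y < n \<and> h y i = p \<and> int t < \<sigma> * z i y}"])
    fix i j assume ij: "i \<in> {..<N}" "j \<in> {..<N}" "i \<noteq> j"
    show "{y. y < n \<and> h y i = p \<and> int t < \<sigma> * z i y} \<inter> {y. y < n \<and> h y j = p \<and> int t < \<sigma> * z j y} = {}"
    proof -
      have False if "y < n" "h y i = p" "h y j = p" "int t < \<sigma> * z i y" "int t < \<sigma> * z j y" for y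
      proof -
        have "z i y \<noteq> 0" "z j y \<noteq> 0" using that(4,5) by auto
        then show False using inj_onD[OF h(1)[OF that(1)], of i j] that ij by auto
      qed
      then show ?thesis by blast
    qed
  next
    fix x y assume "x < m" "y < n"
    show "B p t \<sigma> x y = (if \<exists>i\<in>{..<N}. x \<in> D i \<and> y \<in> {y. y < n \<and> h y i = p \<and> int t < \<sigma> * z i y} then 1 else 0)"
    proof (cases "\<exists>i<N. x \<in> D i")
      case True
      then obtain i where i: "i < N" "x \<in> D i" by blast
      have "B p t \<sigma> x y = (\<Sum>j<N. if x \<in> D j then (if h y j = p \<and> int t < \<sigma> * z j y then 1 else 0) else 0)"
        unfolding B_def by (intro sum.cong) auto
      also have "\<dots> = (if h y i = p \<and> int t < \<sigma> * z i y then 1 else 0)" using disj i by (intro sum_if_disjoint) auto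
      also have "\<dots> = (if \<exists>j\<in>{..<N}. x \<in> D j \<and> y \<in> {y. y < n \<and> h y j = p \<and> int t < \<sigma> * z j y} then 1 else 0)"
      proof -
        have "j = i" if "j < N" "x \<in> D j" for j using disj[of i j] i that by blast
        then have "(\<exists>j\<in>{..<N}. x \<in> D j \<and> y \<in> {y. y < n \<and> h y j = p \<and> int t < \<sigma> * z j y})
            \<longleftrightarrow> h y i = p \<and> int t < \<sigma> * z i y"
          using i \<open>y < n\<close> by blast
        then show ?thesis by simp
      qed
      finally show ?thesis .
    next
      case False
      then show ?thesis unfolding B_def by auto
    qed
  qed (use D disj in auto)
  have "signed_blocky_sum m n (s * (g * 2)) (\<lambda>x y. \<Sum>p<s. \<Sum>t<g. B p t 1 x y + - B p t (-1) x y)"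
  proof (intro signed_blocky_sum_sum)
    fix p t
    show "signed_blocky_sum m n 2 (\<lambda>x y. B p t 1 x y + - B p t (-1) x y)"
      using signed_blocky_sum_add[OF signed_blocky_sum_blocky(1)[OF blB[of p t 1]] signed_blocky_sum_blocky(2)[OF blB[of p t "-1"]]]
      by (simp add: numeral_2_eq_2)
  qed
  then show ?thesis
  proof (rule signed_blocky_sum_cong)
    fix x y assume xy: "x < m" "y < n"
    \<comment> \<open>Layer-cake count: the levels below \<open>c\<close> number the positive part
      of \<open>c\<close>, those below \<open>- c\<close> its negative part, and \<open>g\<close>
      levels suffice for both.\<close>
    have level: "(\<Sum>t<g. (if int t < c then 1 else 0) - (if int t < - c then 1 else 0)) = c"
      if "\<bar>c\<bar> \<le> int g" for c
    proof -
      have "(\<Sum>t<g. (if int t < c then 1 else 0)) = min (int g) (max 0 c)" for c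
        by (induction g) auto
      then have "(\<Sum>t<g. (if int t < c then 1 else 0) - (if int t < - c then 1 else 0))
          = min (int g) (max 0 c) - min (int g) (max 0 (- c))"
        by (simp add: sum_subtractf)
      then show ?thesis using that by auto
    qed
    have "(\<Sum>p<s. \<Sum>t<g. B p t 1 x y + - B p t (-1) x y)
      = (\<Sum>p<s. \<Sum>t<g. \<Sum>i<N. if x \<in> D i \<and> h y i = p then
          (if int t < z i y then 1 else 0) - (if int t < - z i y then 1 else 0) else 0)"
      unfolding B_def by (intro sum.cong refl, simp only: add_uminus_conv_diff sum_subtractf[symmetric])
        (intro sum.cong refl, auto)
    also have "\<dots> = (\<Sum>p<s. \<Sum>i<N. \<Sum>t<g. if x \<in> D i \<and> h y i = p then
          (if int t < z i y then 1 else 0) - (if int t < - z i y then 1 else 0) else 0)"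
      by (intro sum.cong refl sum.swap)
    also have "\<dots> = (\<Sum>p<s. \<Sum>i<N. if x \<in> D i \<and> h y i = p then z i y else 0)"
    proof (intro sum.cong refl)
      fix p i assume "i \<in> {..<N}"
      then have "\<bar>z i y\<bar> \<le> int g" using z xy by simp
      from level[OF this] show "(\<Sum>t<g. if x \<in> D i \<and> h y i = p then
          (if int t < z i y then 1 else 0) - (if int t < - z i y then 1 else 0) else 0)
        = (if x \<in> D i \<and> h y i = p then z i y else 0)"
        by (cases "x \<in> D i \<and> h y i = p") auto
    qed
    also have "\<dots> = (\<Sum>i<N. \<Sum>p<s. if x \<in> D i \<and> h y i = p then z i y else 0)"
      by (rule sum.swap)
    also have "\<dots> = (\<Sum>i<N. if x \<in> D i then z i y else 0)"
    proof (intro sum.cong refl)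
      fix i assume i: "i \<in> {..<N}"
      show "(\<Sum>p<s. if x \<in> D i \<and> h y i = p then z i y else 0) = (if x \<in> D i then z i y else 0)"
      proof (cases "z i y = 0")
        case True
        then show ?thesis by (simp add: if_distrib cong: if_cong)
      next
        case False
        then have "h y i < s" using h(2)[OF xy(2)] i by auto
        then show ?thesis by (cases "x \<in> D i") simp_all
      qed
    qed
    finally show "(\<Sum>i<N. if x \<in> D i then z i y else 0) = (\<Sum>p<s. \<Sum>t<g. B p t 1 x y + - B p t (-1) x y)"
      by simp
  qed
qed

section \<open>Inner products and means\<close>

definition ip :: "nat \<Rightarrow> (nat \<Rightarrow> real) \<Rightarrow> (nat \<Rightarrow> real) \<Rightarrow> real" where
  "ip d a b = (\<Sum>k<d. a k * b k)"

definition mean :: "('a \<Rightarrow> nat \<Rightarrow> real) \<Rightarrow> 'a set \<Rightarrow> nat \<Rightarrow> real" where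
  "mean u R = (\<lambda>k. (\<Sum>x\<in>R. u x k) / card R)"

lemma ip_commute: "ip d a b = ip d b a"
  by (simp add: ip_def mult.commute)

lemma ip_diff_left: "ip d (\<lambda>k. a k - b k) c = ip d a c - ip d b c"
  by (simp add: ip_def left_diff_distrib sum_subtractf)

lemma ip_self_nonneg: "0 \<le> ip d a a"
  unfolding ip_def by (intro sum_nonneg) simp

lemma ip_diff_self: "ip d (\<lambda>k. a k - b k) (\<lambda>k. a k - b k) = ip d a a - 2 * ip d a b + ip d b b"
  by (simp add: ip_def algebra_simps sum_subtractf sum.distrib sum_distrib_left)

lemma ip_Cauchy_Schwarz: "(ip d a b)\<^sup>2 \<le> ip d a a * ip d b b"
  using Cauchy_Schwarz_ineq_sum[of a b "{..<d}"] by (simp add: ip_def power2_eq_square)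

lemma ip_mean: "ip d (mean u R) b = (\<Sum>x\<in>R. ip d (u x) b) / card R"
proof -
  have "(\<Sum>k<d. (\<Sum>x\<in>R. u x k) / card R * b k) = (\<Sum>k<d. \<Sum>x\<in>R. u x k * b k) / card R"
    by (simp add: sum_divide_distrib sum_distrib_right)
  also have "(\<Sum>k<d. \<Sum>x\<in>R. u x k * b k) = (\<Sum>x\<in>R. \<Sum>k<d. u x k * b k)"
    by (rule sum.swap)
  finally show ?thesis by (simp add: ip_def mean_def)
qed

text \<open>Average \<open>2 * ip d (u x) w \<le> E + ip d w w\<close> over \<open>R\<close>, where
  \<open>w\<close> is the mean: the left side averages to \<open>2 * ip d w w\<close>.\<close>

lemma ip_mean_self_le:
  assumes "finite R" "R \<noteq> {}" "\<And>x. x \<in> R \<Longrightarrow> ip d (u x) (u x) \<le> E"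
  shows "ip d (mean u R) (mean u R) \<le> E"
proof -
  let ?w = "mean u R"
  have "ip d (u x) ?w \<le> (E + ip d ?w ?w) / 2" if "x \<in> R" for x
    using ip_self_nonneg[of d "\<lambda>k. u x k - ?w k"] assms(3)[OF that] by (simp add: ip_diff_self)
  then have "(\<Sum>x\<in>R. ip d (u x) ?w) \<le> card R * ((E + ip d ?w ?w) / 2)"
    by (rule sum_bounded_above)
  moreover have "0 < real (card R)" using assms(1,2) by (simp add: card_gt_0_iff)
  ultimately have "ip d ?w ?w \<le> (E + ip d ?w ?w) / 2"
    unfolding ip_mean[of d u R ?w] by (simp add: field_simps)
  then show ?thesis by simp
qed

text \<open>The exact convexity defect of the squared norm, that is, the variance of a two-point
  distribution. It converts a loss of potential into a squared distance between two means.\<close>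

lemma ip_convex_combination:
  assumes "p + q = 1" "\<And>k. k < d \<Longrightarrow> w k = p * a k + q * b k"
  shows "p * ip d a a + q * ip d b b - ip d w w = p * q * ip d (\<lambda>k. a k - b k) (\<lambda>k. a k - b k)"
proof -
  have q: "q = 1 - p" using assms(1) by simp
  have "ip d w w = (\<Sum>k<d. (p * a k + q * b k) * (p * a k + q * b k))"
    unfolding ip_def by (intro sum.cong) (simp_all add: assms(2))
  then have "p * ip d a a + q * ip d b b - ip d w w
    = (\<Sum>k<d. p * (a k * a k) + q * (b k * b k) - (p * a k + q * b k) * (p * a k + q * b k))"
    by (simp add: ip_def sum_distrib_left sum.distrib sum_subtractf)
  also have "\<dots> = (\<Sum>k<d. p * q * ((a k - b k) * (a k - b k)))"
    by (intro sum.cong refl) (simp add: q algebra_simps)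
  finally show ?thesis by (simp add: ip_def sum_distrib_left)
qed

section \<open>Clusters on which all columns are almost constant\<close>

text \<open>Trades size against the length of the mean: a subset pays the logarithm of its relative
  density and may be rewarded by a longer mean.\<close>

definition potential :: "real \<Rightarrow> nat \<Rightarrow> ('a \<Rightarrow> nat \<Rightarrow> real) \<Rightarrow> 'a set \<Rightarrow> real" where
  "potential \<beta> d u R = ln (card R) + \<beta> * ip d (mean u R) (mean u R)"

text \<open>A maximizer over the nonempty subsets of \<open>T\<close> is compared with
  \<open>T\<close> itself: \<open>T\<close> has potential at least \<open>ln (card T)\<close>, while
  that of \<open>R\<close> is at most \<open>ln (card R) + \<beta> * E\<close>.\<close>

lemma potential_maximizer:
  assumes "finite T" "T \<noteq> {}" "0 \<le> \<beta>" "\<And>x. x \<in> T \<Longrightarrow> ip d (u x) (u x) \<le> E"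
  shows "\<exists>R. R \<subseteq> T \<and> R \<noteq> {} \<and> exp (- \<beta> * E) * card T \<le> card R \<and>
    (\<forall>P. P \<subseteq> R \<longrightarrow> P \<noteq> {} \<longrightarrow> potential \<beta> d u P \<le> potential \<beta> d u R)"
proof -
  define \<Omega> where "\<Omega> = Pow T - {{}}"
  have \<Omega>: "finite \<Omega>" "T \<in> \<Omega>" using assms(1,2) by (auto simp: \<Omega>_def)
  define M where "M = Max (potential \<beta> d u ` \<Omega>)"
  have "M \<in> potential \<beta> d u ` \<Omega>" unfolding M_def using \<Omega> by (intro Max_in) auto
  then obtain R where R: "R \<in> \<Omega>" "potential \<beta> d u R = M" by auto
  have max: "potential \<beta> d u P \<le> potential \<beta> d u R" if "P \<in> \<Omega>" for P
    unfolding R(2) M_def using \<Omega>(1) that by (intro Max_ge) auto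
  have RT: "R \<subseteq> T" "R \<noteq> {}" "finite R" using R(1) assms(1) finite_subset by (auto simp: \<Omega>_def)
  have cT: "0 < real (card T)" and cR: "0 < real (card R)"
    using RT assms(1,2) by (simp_all add: card_gt_0_iff)
  have "ln (card T) \<le> potential \<beta> d u T"
    unfolding potential_def using assms(3) ip_self_nonneg[of d "mean u T"] by simp
  also have "\<dots> \<le> potential \<beta> d u R" by (rule max[OF \<Omega>(2)])
  also have "\<dots> \<le> ln (card R) + \<beta> * E"
    unfolding potential_def using RT assms(3,4)
    by (intro add_left_mono mult_left_mono ip_mean_self_le) auto
  finally have "ln (card T) - \<beta> * E \<le> ln (card R)" by simp
  then have "exp (ln (card T) - \<beta> * E) \<le> exp (ln (card R))" by simp
  then have "exp (- \<beta> * E) * card T \<le> card R"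
    using cT cR by (simp add: exp_diff exp_minus field_simps)
  moreover have "potential \<beta> d u P \<le> potential \<beta> d u R" if "P \<subseteq> R" "P \<noteq> {}" for P
    using max[of P] that RT(1) by (auto simp: \<Omega>_def)
  ultimately show ?thesis using RT(1,2) by blast
qed

text \<open>Adding the two maximality inequalities with weights \<open>p\<close> and \<open>q\<close> bounds
  \<open>\<beta> p q \<parallel>mean P - mean (R - P)\<parallel>\<^sup>2\<close> by the binary entropy of \<open>p\<close>.\<close>

lemma potential_separated_part_small:
  assumes fin: "finite R" and P: "P \<subseteq> R" "P \<noteq> {}" "P \<noteq> R"
    and \<beta>: "0 \<le> \<beta>"
    and max: "\<And>P. P \<subseteq> R \<Longrightarrow> P \<noteq> {} \<Longrightarrow> potential \<beta> d u P \<le> potential \<beta> d u R"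
    and v: "ip d v v \<le> 1"
    and sep: "1 / 2 \<le> \<bar>ip d (mean u P) v - ip d (mean u (R - P)) v\<bar>"
    and half: "2 * card P \<le> card R"
  shows "card P \<le> exp (1 - \<beta> / 8) * card R"
proof -
  define Q where "Q = R - P"
  have Q: "Q \<subseteq> R" "Q \<noteq> {}" "finite Q" and finP: "finite P"
    using P fin finite_subset unfolding Q_def by auto
  define r where "r = real (card R)"
  define p where "p = card P / r"
  define q where "q = card Q / r"
  have cards: "0 < card P" "0 < card Q" using P(2) Q finP by (simp_all add: card_gt_0_iff)
  have sum_card: "card P + card Q = card R"
    unfolding Q_def using P(1) fin by (metis card_Diff_subset card_mono finP le_add_diff_inverse)
  have r: "0 < r" using cards sum_card unfolding r_def by linarith
  have pq: "p + q = 1" "0 < p" "0 < q" "p \<le> 1 / 2"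
    using cards sum_card half r by (auto simp: p_def q_def r_def field_simps)
  have pr: "real (card P) = p * r" and qr: "real (card Q) = q * r"
    using r by (simp_all add: p_def q_def)
  let ?a = "mean u P" and ?b = "mean u Q" and ?w = "mean u R"
  have w: "?w k = p * ?a k + q * ?b k" for k
  proof -
    have "(\<Sum>x\<in>R. u x k) = (\<Sum>x\<in>P. u x k) + (\<Sum>x\<in>Q. u x k)"
      using sum.subset_diff[OF P(1) fin, of "\<lambda>x. u x k"] unfolding Q_def by simp
    then show ?thesis
      using cards r by (simp add: mean_def p_def q_def r_def add_divide_distrib)
  qed
  \<comment> \<open>The summand \<open>ln (card R)\<close> cancels on both sides, so only the
    relative densities \<open>p\<close> and \<open>q\<close> remain.\<close>
  have mP: "ln p + \<beta> * ip d ?a ?a \<le> \<beta> * ip d ?w ?w"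
    using max[OF P(1,2)] pq r unfolding potential_def pr r_def[symmetric] by (simp add: ln_mult)
  have mQ: "ln q + \<beta> * ip d ?b ?b \<le> \<beta> * ip d ?w ?w"
    using max[OF Q(1,2)] pq r unfolding potential_def qr r_def[symmetric] by (simp add: ln_mult)
  define D where "D = ip d (\<lambda>k. ?a k - ?b k) (\<lambda>k. ?a k - ?b k)"
  have "p * (ln p + \<beta> * ip d ?a ?a) + q * (ln q + \<beta> * ip d ?b ?b)
      \<le> p * (\<beta> * ip d ?w ?w) + q * (\<beta> * ip d ?w ?w)"
    using mP mQ pq by (intro add_mono mult_left_mono) auto
  also have "\<dots> = (p + q) * (\<beta> * ip d ?w ?w)" by (simp add: algebra_simps)
  finally have "p * ln p + q * ln q + \<beta> * (p * ip d ?a ?a + q * ip d ?b ?b - ip d ?w ?w) \<le> 0"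
    unfolding pq(1) by (simp add: algebra_simps)
  then have ent: "p * ln p + q * ln q + \<beta> * (p * q * D) \<le> 0"
    using ip_convex_combination[OF pq(1), of d ?w ?a ?b] w unfolding D_def by simp
  \<comment> \<open>By Cauchy-Schwarz, a gap of \<open>1 / 2\<close> in the direction
    \<open>v\<close> forces squared distance at least \<open>1 / 4\<close> between the two
    means.\<close>
  have "(1 / 2)\<^sup>2 \<le> (ip d (\<lambda>k. ?a k - ?b k) v)\<^sup>2"
    using sep unfolding ip_diff_left Q_def by (metis abs_ge_zero power2_abs power_mono half_gt_zero_iff less_imp_le zero_less_one)
  also have "\<dots> \<le> D * ip d v v" unfolding D_def by (rule ip_Cauchy_Schwarz)
  also have "\<dots> \<le> D" using v ip_self_nonneg unfolding D_def by (simp add: mult_left_le)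
  finally have D: "1 / 4 \<le> D" by (simp add: power2_eq_square)
  \<comment> \<open>The larger part has entropy \<open>- q * ln q \<le> 1 - q = p\<close>. With
    \<open>q \<ge> 1 / 2\<close> and \<open>D \<ge> 1 / 4\<close> a factor \<open>p\<close> cancels
    from the whole inequality, leaving \<open>ln p \<le> 1 - \<beta> / 8\<close>.\<close>
  have "- ln q \<le> 1 / q - 1" using ln_le_minus_one[of "1 / q"] pq by (simp add: ln_div)
  then have "q * (- ln q) \<le> q * (1 / q - 1)" using pq by (intro mult_left_mono) auto
  also have "\<dots> = 1 - q" using pq(3) by (simp add: right_diff_distrib)
  also have "\<dots> = p" using pq(1) by simp
  finally have "p * ln p - p + \<beta> * (p * q * D) \<le> 0" using ent by simp
  moreover have "\<beta> * (p * (1 / 2) * (1 / 4)) \<le> \<beta> * (p * q * D)"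
    using pq D \<beta> by (intro mult_left_mono mult_mono) auto
  ultimately have "p * (ln p - 1 + \<beta> / 8) \<le> 0" by (simp add: algebra_simps)
  then have "ln p \<le> 1 - \<beta> / 8" using pq(2) by (simp add: mult_le_0_iff)
  then have "p \<le> exp (1 - \<beta> / 8)" using pq(2) by (metis exp_le_cancel_iff exp_ln)
  then show ?thesis using pr r unfolding r_def[symmetric] by simp
qed

section \<open>From lopsided thresholds to almost constant columns\<close>

text \<open>Take \<open>z\<close> where the upper tail \<open>{x\<in>R. c \<le> f x}\<close> drops
  from at least half to less than half between \<open>c = z\<close> and \<open>c = z + 1\<close>.
  The small sides of these two thresholds are then the values below \<open>z\<close> and the values
  above \<open>z\<close>, each at most an \<open>\<eta>\<close> fraction.\<close>

lemma mode_from_thresholds: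
  fixes f :: "'a \<Rightarrow> int" and \<eta> :: real
  assumes R: "finite R" "R \<noteq> {}" and \<eta>: "\<eta> < 1 / 2"
    and thr: "\<And>c. card {x\<in>R. c \<le> f x} \<le> \<eta> * card R \<or> card {x\<in>R. f x < c} \<le> \<eta> * card R"
  shows "\<exists>z. card {x\<in>R. f x \<noteq> z} \<le> 2 * \<eta> * card R"
proof -
  define P where "P c \<longleftrightarrow> card R \<le> 2 * card {x\<in>R. c \<le> f x}" for c
  have cR: "0 < real (card R)" using R by (simp add: card_gt_0_iff)
  have "\<exists>z. P z \<and> \<not> P (z + 1)"
  proof (rule ccontr)
    \<comment> \<open>Otherwise \<open>P\<close> would propagate from the minimum of
      \<open>f\<close> past its maximum, where the upper tail is empty.\<close>
    assume *: "\<nexists>z. P z \<and> \<not> P (z + 1)"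
    have "{x\<in>R. Min (f ` R) \<le> f x} = R" using R by auto
    then have base: "P (Min (f ` R))" unfolding P_def by simp
    have "P c" if "Min (f ` R) \<le> c" for c
      using that by (induction rule: int_ge_induct) (use base * in auto)
    moreover have empty: "{x\<in>R. max (Min (f ` R)) (Max (f ` R) + 1) \<le> f x} = {}"
    proof -
      have "f x \<le> Max (f ` R)" if "x \<in> R" for x using R that by (intro Max_ge) auto
      then show ?thesis by force
    qed
    have "\<not> P (max (Min (f ` R)) (Max (f ` R) + 1))"
      unfolding P_def empty using cR by simp
    ultimately show False by (meson max.cobounded1)
  qed
  then obtain z where z: "P z" "\<not> P (z + 1)" by blast
  have split: "card {x\<in>R. c \<le> f x} + card {x\<in>R. f x < c} = card R" for c
  proof -
    have "card ({x\<in>R. c \<le> f x} \<union> {x\<in>R. f x < c}) = card {x\<in>R. c \<le> f x} + card {x\<in>R. f x < c}"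
      using R by (intro card_Un_disjoint) auto
    moreover have "{x\<in>R. c \<le> f x} \<union> {x\<in>R. f x < c} = R" by auto
    ultimately show ?thesis by simp
  qed
  have "\<eta> * card R < (1 / 2) * card R" using \<eta> cR by (intro mult_strict_right_mono) auto
  then have small: "\<eta> * card R < card R / 2" by simp
  have a: "card {x\<in>R. f x < z} \<le> \<eta> * card R"
    using thr[of z] z(1) small unfolding P_def by linarith
  have b: "card {x\<in>R. z + 1 \<le> f x} \<le> \<eta> * card R"
    using thr[of "z + 1"] z(2) small split[of "z + 1"] unfolding P_def by linarith
  have "{x\<in>R. f x \<noteq> z} = {x\<in>R. f x < z} \<union> {x\<in>R. z + 1 \<le> f x}" by auto
  then have "card {x\<in>R. f x \<noteq> z} \<le> card {x\<in>R. f x < z} + card {x\<in>R. z + 1 \<le> f x}"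
    using card_Un_le[of "{x\<in>R. f x < z}" "{x\<in>R. z + 1 \<le> f x}"] by simp
  then have "card {x\<in>R. f x \<noteq> z} \<le> 2 * \<eta> * card R" using a b by simp
  then show ?thesis ..
qed

text \<open>A potential maximizer refers to no column, so one \<open>R\<close> serves all of
  \<open>Y\<close>. If a threshold splits a column on \<open>R\<close> into two nonempty parts,
  integrality separates the means of the parts in the direction \<open>v y\<close>, hence the
  smaller part is tiny; \<open>mode_from_thresholds\<close> then gives the common value.\<close>

lemma column_constant_cluster:
  fixes Z :: "'a \<Rightarrow> 'b \<Rightarrow> int"
  assumes T: "finite T" "T \<noteq> {}" and \<beta>: "0 \<le> \<beta>" "exp (1 - \<beta> / 8) < 1 / 2"
    and u: "\<And>x. x \<in> T \<Longrightarrow> ip d (u x) (u x) \<le> E"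
    and v: "\<And>y. y \<in> Y \<Longrightarrow> ip d (v y) (v y) \<le> 1"
    and Z: "\<And>x y. x \<in> T \<Longrightarrow> y \<in> Y \<Longrightarrow> \<bar>Z x y - ip d (u x) (v y)\<bar> \<le> e" and e: "e \<le> 1 / 4"
  obtains R z where "R \<subseteq> T" "R \<noteq> {}" "exp (- \<beta> * E) * card T \<le> card R"
    "\<And>y. y \<in> Y \<Longrightarrow> card {x\<in>R. Z x y \<noteq> z y} \<le> 2 * exp (1 - \<beta> / 8) * card R"
proof -
  obtain R where R: "R \<subseteq> T" "R \<noteq> {}" "exp (- \<beta> * E) * card T \<le> card R"
    and "\<forall>P. P \<subseteq> R \<longrightarrow> P \<noteq> {} \<longrightarrow> potential \<beta> d u P \<le> potential \<beta> d u R"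
    using potential_maximizer[of T \<beta> d u E, OF T \<beta>(1)] u
    by (metis (no_types, lifting))
  then have max: "\<And>P. P \<subseteq> R \<Longrightarrow> P \<noteq> {} \<Longrightarrow> potential \<beta> d u P \<le> potential \<beta> d u R" by simp
  have finR: "finite R" using R(1) T(1) finite_subset by blast
  let ?\<eta> = "exp (1 - \<beta> / 8)"
  have "\<exists>z. card {x\<in>R. Z x y \<noteq> z} \<le> 2 * ?\<eta> * card R" if y: "y \<in> Y" for y
  proof (rule mode_from_thresholds[OF finR R(2) \<beta>(2)])
    fix c
    define P where "P = {x\<in>R. c \<le> Z x y}"
    have RP: "R - P = {x\<in>R. Z x y < c}" unfolding P_def by auto
    have PR: "P \<subseteq> R" "finite P" "finite (R - P)" unfolding P_def using finR by auto
    have cards: "card P + card (R - P) = card R"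
      using PR finR by (metis card_Diff_subset card_mono le_add_diff_inverse)
    have "card P \<le> ?\<eta> * card R \<or> card (R - P) \<le> ?\<eta> * card R"
    proof (cases "P = {} \<or> R - P = {}")
      case True
      then have "card P = 0 \<or> card (R - P) = 0" by (metis card.empty)
      then show ?thesis by auto
    next
      case False
      then have ne: "P \<noteq> {}" "R - P \<noteq> {}" by auto
      have cpos: "0 < real (card P)" "0 < real (card (R - P))" using ne PR by (simp_all add: card_gt_0_iff)
      have "of_int c - e \<le> ip d (u x) (v y)" if "x \<in> P" for x
        using Z[of x y] that R(1) y unfolding P_def by force
      then have "card P * (of_int c - e) \<le> (\<Sum>x\<in>P. ip d (u x) (v y))"
        by (rule sum_bounded_below)
      then have 1: "of_int c - e \<le> ip d (mean u P) (v y)"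
        unfolding ip_mean using cpos by (simp add: field_simps)
      have "ip d (u x) (v y) \<le> of_int c - 1 + e" if "x \<in> R - P" for x
      proof -
        have "Z x y \<le> c - 1" using that unfolding P_def by auto
        then have "real_of_int (Z x y) \<le> of_int c - 1" by linarith
        then show ?thesis using Z[of x y] that R(1) y by force
      qed
      then have "(\<Sum>x\<in>R - P. ip d (u x) (v y)) \<le> card (R - P) * (of_int c - 1 + e)"
        by (rule sum_bounded_above)
      then have 2: "ip d (mean u (R - P)) (v y) \<le> of_int c - 1 + e"
        unfolding ip_mean using cpos by (simp add: field_simps)
      \<comment> \<open>Entries on the two sides differ by at least 1 and each mean is off by at
        most \<open>e \<le> 1 / 4\<close>, which leaves
        \<open>1 - 2 * e \<ge> 1 / 2\<close>.\<close>
      have sep: "1 / 2 \<le> ip d (mean u P) (v y) - ip d (mean u (R - P)) (v y)"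
        using 1 2 e by linarith
      show ?thesis
      proof (cases "2 * card P \<le> card R")
        case True
        have "card P \<le> ?\<eta> * card R"
          by (rule potential_separated_part_small[OF finR PR(1) ne(1) _ \<beta>(1) max v[OF y] _ True])
             (use ne sep in auto)
        then show ?thesis ..
      next
        case False
        have RRP: "R - (R - P) = P" using PR by auto
        have "card (R - P) \<le> ?\<eta> * card R"
          by (rule potential_separated_part_small[where P = "R - P", OF finR _ ne(2) _ \<beta>(1) max v[OF y]])
             (use ne sep False cards PR in \<open>auto simp: RRP abs_minus_commute\<close>)
        then show ?thesis ..
      qed
    qed
    then show "card {x\<in>R. c \<le> Z x y} \<le> ?\<eta> * card R \<or> card {x\<in>R. Z x y < c} \<le> ?\<eta> * card R"
      unfolding RP unfolding P_def .
  qed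
  then have "\<forall>y\<in>Y. \<exists>z. card {x\<in>R. Z x y \<noteq> z} \<le> 2 * ?\<eta> * card R" by blast
  from bchoice[OF this] obtain z where "\<forall>y\<in>Y. card {x\<in>R. Z x y \<noteq> z y} \<le> 2 * ?\<eta> * card R" ..
  then show ?thesis using that[OF R, of z] by simp
qed

section \<open>Greedy covers\<close>

text \<open>Each stage takes the \<open>F b\<close> that meets the uncovered part most and removes
  this intersection. The tail estimate is the maximality of the \<open>i\<close>-th choice, because
  the \<open>T j\<close> with \<open>i \<le> j\<close> partition what was uncovered at that
  stage.\<close>

lemma greedy_disjoint_cover:
  fixes F :: "'b \<Rightarrow> 'a set"
  assumes "finite S" "finite Y" "S \<subseteq> (\<Union>y\<in>Y. F y)"
  shows "\<exists>(N::nat) T f. (\<forall>i<N. T i \<noteq> {} \<and> T i \<subseteq> F (f i) \<and> f i \<in> Y) \<and>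
     (\<forall>i<N. \<forall>j<N. i \<noteq> j \<longrightarrow> T i \<inter> T j = {}) \<and> (\<Union>i<N. T i) = S \<and>
     (\<forall>y\<in>Y. \<forall>i<N. (\<Sum>j=i..<N. card (F y \<inter> T j)) \<le> card (T i))"
  using assms(1,3)
proof (induction "card S" arbitrary: S rule: less_induct)
  case less
  show ?case
  proof (cases "S = {}")
    case True
    then show ?thesis by (intro exI[of _ 0]) auto
  next
    case False
    then have "Y \<noteq> {}" using less.prems by auto
    define g where "g y = card (F y \<inter> S)" for y
    have "Max (g ` Y) \<in> g ` Y" using assms(2) \<open>Y \<noteq> {}\<close> by (intro Max_in) auto
    then obtain b where b: "b \<in> Y" "g b = Max (g ` Y)" by auto
    have best: "g y \<le> g b" if "y \<in> Y" for y
      unfolding b(2) using assms(2) that by (intro Max_ge) auto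
    define S0 where "S0 = F b \<inter> S"
    obtain x y where xy: "x \<in> S" "y \<in> Y" "x \<in> F y" using False less.prems by blast
    then have "0 < g y" unfolding g_def using less.prems by (auto simp: card_gt_0_iff)
    then have "0 < g b" using best[OF xy(2)] by linarith
    then have S0: "S0 \<noteq> {}" "S0 \<subseteq> S" unfolding g_def S0_def by auto
    have "card (S - S0) < card S" using S0 less.prems by (intro psubset_card_mono) auto
    then have "\<exists>(N::nat) T f. (\<forall>i<N. T i \<noteq> {} \<and> T i \<subseteq> F (f i) \<and> f i \<in> Y) \<and>
        (\<forall>i<N. \<forall>j<N. i \<noteq> j \<longrightarrow> T i \<inter> T j = {}) \<and> (\<Union>i<N. T i) = S - S0 \<and>
        (\<forall>y\<in>Y. \<forall>i<N. (\<Sum>j=i..<N. card (F y \<inter> T j)) \<le> card (T i))"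
      by (rule less.hyps) (use less.prems in auto)
    then obtain N :: nat and T f where
      IH1: "\<forall>i<N. T i \<noteq> {} \<and> T i \<subseteq> F (f i) \<and> f i \<in> Y" and
      IH2: "\<forall>i<N. \<forall>j<N. i \<noteq> j \<longrightarrow> T i \<inter> T j = {}" and
      IH3: "(\<Union>i<N. T i) = S - S0" and
      IH4: "\<forall>y\<in>Y. \<forall>i<N. (\<Sum>j=i..<N. card (F y \<inter> T j)) \<le> card (T i)"
      by (elim exE conjE) (rule that; assumption)
    \<comment> \<open>The new choice goes in front. For index 0 the tail is all of
      \<open>F y \<inter> S\<close> and the maximality of \<open>b\<close> applies; later tails are
      those of the recursive cover.\<close>
    let ?T = "case_nat S0 T"
    have fin: "finite (T i)" if "i < N" for i
      using IH3 that less.prems(1) by (metis UN_upper finite_Diff finite_subset lessThan_iff)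
    have S0T: "S0 \<inter> T i = {}" if "i < N" for i using IH3 that by blast
    show ?thesis
    proof (intro exI[of _ "Suc N"] exI[of _ ?T] exI[of _ "case_nat b f"] conjI allI impI ballI)
      fix y i assume y: "y \<in> Y" and i: "i < Suc N"
      show "(\<Sum>j=i..<Suc N. card (F y \<inter> ?T j)) \<le> card (?T i)"
      proof (cases i)
        case 0
        have "(\<Sum>j=0..<Suc N. card (F y \<inter> ?T j)) = card (F y \<inter> S0) + (\<Sum>j<N. card (F y \<inter> T j))"
          by (simp add: atLeast0LessThan sum.lessThan_Suc_shift del: sum.lessThan_Suc)
        also have "(\<Sum>j<N. card (F y \<inter> T j)) = card (\<Union>j<N. F y \<inter> T j)"
          using IH2 fin by (intro card_UN_disjoint[symmetric]) auto
        also have "(\<Union>j<N. F y \<inter> T j) = F y \<inter> (S - S0)" using IH3 by auto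
        also have "card (F y \<inter> S0) + card (F y \<inter> (S - S0)) = card (F y \<inter> S)"
        proof -
          have "card ((F y \<inter> S0) \<union> (F y \<inter> (S - S0))) = card (F y \<inter> S0) + card (F y \<inter> (S - S0))"
            using less.prems S0 finite_subset[of S0 S] by (intro card_Un_disjoint) auto
          moreover have "(F y \<inter> S0) \<union> (F y \<inter> (S - S0)) = F y \<inter> S" using S0 by auto
          ultimately show ?thesis by simp
        qed
        also have "\<dots> \<le> card S0" using best[OF y] unfolding g_def S0_def by simp
        finally show ?thesis using 0 by simp
      next
        case (Suc i')
        then have "(\<Sum>j=i..<Suc N. card (F y \<inter> ?T j)) = (\<Sum>j=i'..<N. card (F y \<inter> T j))"
          by (simp add: sum.shift_bounds_Suc_ivl del: sum.op_ivl_Suc)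
        also have "\<dots> \<le> card (T i')" using IH4 y i Suc by simp
        finally show ?thesis using Suc by simp
      qed
    next
      fix i j assume "i < Suc N" "j < Suc N" "i \<noteq> j"
      then show "?T i \<inter> ?T j = {}"
        using IH2 S0T by (cases i; cases j) (auto simp: Int_commute)
    next
      show "(\<Union>i<Suc N. ?T i) = S"
        unfolding lessThan_Suc_eq_insert_0 using IH3 S0 by (auto simp: image_Union)
    qed (use IH1 S0 b in \<open>auto simp: S0_def split: nat.splits\<close>)
  qed
qed

text \<open>Passing to the tail multiplies the remaining mass by at most \<open>1 - \<kappa> \<le> exp (- \<kappa>)\<close>.\<close>

lemma card_le_of_geometric_tails:
  fixes a :: "nat \<Rightarrow> real"
  assumes "finite I" "I \<noteq> {}" "0 < \<kappa>" "\<And>i. i \<in> I \<Longrightarrow> 1 \<le> a i"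
    and "\<And>i. i \<in> I \<Longrightarrow> \<kappa> * (\<Sum>j\<in>{j\<in>I. i \<le> j}. a j) \<le> a i"
  shows "\<kappa> * (real (card I) - 1) \<le> ln (\<Sum>i\<in>I. a i)"
  using assms(1,2,4,5)
proof (induction "card I" arbitrary: I)
  case 0
  then show ?case by simp
next
  case (Suc c)
  define i where "i = Min I"
  have i: "i \<in> I" "\<And>j. j \<in> I \<Longrightarrow> i \<le> j" using Suc.prems unfolding i_def by auto
  define I' where "I' = I - {i}"
  have sum_I: "(\<Sum>j\<in>I. a j) = a i + (\<Sum>j\<in>I'. a j)"
    unfolding I'_def using Suc.prems i by (simp add: sum.remove)
  show ?case
  proof (cases "I' = {}")
    case True
    \<comment> \<open>The singleton is where the \<open>- 1\<close> in the bound comes from: the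
      left side is 0 and \<open>a i \<ge> 1\<close> makes the logarithm nonnegative.\<close>
    then have "I = {i}" using i unfolding I'_def by auto
    then show ?thesis using Suc.prems(3)[OF i(1)] by simp
  next
    case False
    have finI': "finite I'" using Suc.prems unfolding I'_def by simp
    have card: "c = card I'" using Suc.hyps(2) i(1) Suc.prems unfolding I'_def by simp
    have pos: "0 < (\<Sum>j\<in>I'. a j)"
      using finI' False Suc.prems(3) unfolding I'_def by (intro sum_pos) force+
    have tail: "{j\<in>I. i \<le> j} = I" using i by auto
    have IH: "\<kappa> * (real (card I') - 1) \<le> ln (\<Sum>j\<in>I'. a j)"
    proof (rule Suc.hyps(1)[OF card finI' False])
      fix k assume k: "k \<in> I'"
      show "1 \<le> a k" using k Suc.prems(3) unfolding I'_def by auto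
      have "(\<Sum>j\<in>{j\<in>I'. k \<le> j}. a j) \<le> (\<Sum>j\<in>{j\<in>I. k \<le> j}. a j)"
        using Suc.prems(1,3) unfolding I'_def by (intro sum_mono2) force+
      then have "\<kappa> * (\<Sum>j\<in>{j\<in>I'. k \<le> j}. a j) \<le> \<kappa> * (\<Sum>j\<in>{j\<in>I. k \<le> j}. a j)"
        using assms(3) by simp
      also have "\<dots> \<le> a k" using k Suc.prems(4) unfolding I'_def by auto
      finally show "\<kappa> * (\<Sum>j\<in>{j\<in>I'. k \<le> j}. a j) \<le> a k" .
    qed
    let ?s = "\<Sum>j\<in>I. a j"
    have s: "0 < ?s" unfolding sum_I using pos Suc.prems(3)[OF i(1)] by linarith
    have "(\<Sum>j\<in>I'. a j) \<le> (1 - \<kappa>) * ?s"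
      using Suc.prems(4)[OF i(1)] unfolding tail using sum_I by (simp add: algebra_simps)
    also have "\<dots> \<le> exp (- \<kappa>) * ?s"
      using exp_ge_add_one_self[of "- \<kappa>"] s by (intro mult_right_mono) auto
    finally have "ln (\<Sum>j\<in>I'. a j) \<le> ln (exp (- \<kappa>) * ?s)" using pos by (subst ln_le_cancel_iff) (use s in auto)
    also have "\<dots> = - \<kappa> + ln ?s" using s by (simp add: ln_mult)
    finally have "ln (\<Sum>j\<in>I'. a j) + \<kappa> \<le> ln ?s" by simp
    moreover have "real (card I) = real (card I') + 1" using Suc.hyps(2) card by simp
    ultimately show ?thesis using IH by (simp add: algebra_simps)
  qed
qed

section \<open>Norm decrement\<close>

lemma abs_ip_le:
  assumes "ip d a a \<le> G\<^sup>2" "ip d b b \<le> 1" "0 \<le> G"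
  shows "\<bar>ip d a b\<bar> \<le> G"
proof -
  have "(ip d a b)\<^sup>2 \<le> ip d a a * ip d b b" by (rule ip_Cauchy_Schwarz)
  also have "\<dots> \<le> G\<^sup>2 * 1" using assms ip_self_nonneg by (intro mult_mono) auto
  finally have "\<bar>ip d a b\<bar>\<^sup>2 \<le> G\<^sup>2" by simp
  then show ?thesis using assms(3) by (rule power2_le_imp_le)
qed

text \<open>Here \<open>e\<close> is the current factorisation error, and \<open>\<epsilon>\<close>
  bounds the error of replacing a column's average on \<open>R\<close> by its most frequent value
  \<open>z y\<close>. The set \<open>P R\<close> collects the rows well aligned with the mean, for
  which subtracting the mean shortens the vector.\<close>

lemma cluster_around_mean:
  fixes Z :: "nat \<Rightarrow> nat \<Rightarrow> int"
  assumes T: "finite T" "T \<noteq> {}" and y0: "y0 < n" "\<And>x. x \<in> T \<Longrightarrow> Z x y0 \<noteq> 0"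
    and u: "\<And>x. x \<in> T \<Longrightarrow> ip d (u x) (u x) \<le> E" and E: "E \<le> G\<^sup>2" and G: "1 \<le> G"
    and v: "\<And>y. y < n \<Longrightarrow> ip d (v y) (v y) \<le> 1"
    and Z: "\<And>x y. x \<in> T \<Longrightarrow> y < n \<Longrightarrow> \<bar>Z x y - ip d (u x) (v y)\<bar> \<le> e"
    and \<beta>: "0 \<le> \<beta>" "4 * exp (1 - \<beta> / 8) * (G + 1) \<le> \<epsilon>" and e: "0 \<le> e" "e + \<epsilon> \<le> 1 / 8"
  defines "P \<equiv> \<lambda>R. {x\<in>R. 3 / 4 * ip d (mean u R) (mean u R) \<le> ip d (u x) (mean u R)}"
  shows "\<exists>R z. R \<subseteq> T \<and> exp (- \<beta> * G\<^sup>2) * card T \<le> card R \<and> 3 / (16 * G) * card R \<le> card (P R) \<and>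
    (\<forall>y<n. 2 * card {x\<in>R. Z x y \<noteq> z y} \<le> card R) \<and>
    (\<forall>y<n. \<bar>z y - ip d (mean u R) (v y)\<bar> \<le> e + \<epsilon>) \<and>
    (\<forall>y<n. \<bar>real_of_int (z y)\<bar> \<le> G + 1) \<and>
    (\<forall>x\<in>P R. ip d (\<lambda>k. u x k - mean u R k) (\<lambda>k. u x k - mean u R k) \<le> E - 1 / 4)"
proof -
  let ?\<eta> = "exp (1 - \<beta> / 8)"
  have "?\<eta> * (4 * 2) \<le> ?\<eta> * (4 * (G + 1))" using G by (intro mult_left_mono) auto
  also have "\<dots> = 4 * ?\<eta> * (G + 1)" by simp
  also have "\<dots> \<le> 1 / 8" using \<beta>(2) e by linarith
  finally have \<eta>: "?\<eta> \<le> 1 / 64" by simp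
  have "0 \<le> 4 * ?\<eta> * (G + 1)" using G by simp
  then have e_le: "e \<le> 1 / 8" using \<beta>(2) e by linarith
  obtain R z where R: "R \<subseteq> T" "R \<noteq> {}" "exp (- \<beta> * E) * card T \<le> card R"
    and z0: "\<And>y. y \<in> {..<n} \<Longrightarrow> card {x\<in>R. Z x y \<noteq> z y} \<le> 2 * ?\<eta> * card R"
  proof (rule column_constant_cluster[of T \<beta> d u E "{..<n}" v Z e])
    show "exp (1 - \<beta> / 8) < 1 / 2" using \<eta> by linarith
  qed (use T \<beta>(1) u v Z e_le in auto)
  have z: "card {x\<in>R. Z x y \<noteq> z y} \<le> 2 * ?\<eta> * card R" if "y < n" for y using z0 that by simp
  have finR: "finite R" using R(1) T(1) finite_subset by blast
  have cR: "0 < real (card R)" using R(2) finR by (simp add: card_gt_0_iff)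
  have "exp (- \<beta> * G\<^sup>2) * card T \<le> exp (- \<beta> * E) * card T"
    using \<beta>(1) E by (intro mult_right_mono) (auto intro: mult_left_mono)
  then have large: "exp (- \<beta> * G\<^sup>2) * card T \<le> card R" using R(3) by linarith
  have half: "2 * card {x\<in>R. Z x y \<noteq> z y} \<le> card R" if "y < n" for y
  proof -
    have "2 * ?\<eta> * card R \<le> (1 / 2) * card R" using \<eta> by (intro mult_right_mono) auto
    then show ?thesis using z[OF that] by linarith
  qed
  have ipG: "\<bar>ip d (u x) (v y)\<bar> \<le> G" if "x \<in> R" "y < n" for x y
    using u[of x] v[of y] E G R(1) that by (intro abs_ip_le) auto
  have ZG: "\<bar>real_of_int (Z x y)\<bar> \<le> G + 1" if "x \<in> R" "y < n" for x y
  proof -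
    have "x \<in> T" using that R(1) by blast
    then show ?thesis
      using Z[of x y] ipG[OF that] that(2) e_le by simp
  qed
  \<comment> \<open>At most half of \<open>R\<close> is exceptional, so \<open>z y\<close> is an
    actual entry and inherits the size bound and, at \<open>y0\<close>, the nonvanishing.\<close>
  have attained: "\<exists>x\<in>R. Z x y = z y" if "y < n" for y
  proof (rule ccontr)
    assume "\<not> (\<exists>x\<in>R. Z x y = z y)"
    then have "{x\<in>R. Z x y \<noteq> z y} = R" by auto
    then show False using half[OF that] cR by simp
  qed
  have zG: "\<bar>real_of_int (z y)\<bar> \<le> G + 1" if y: "y < n" for y
  proof -
    obtain x where "x \<in> R" "Z x y = z y" using attained[OF y] by blast
    then show ?thesis using ZG[of x y] y by simp
  qed
  let ?w = "mean u R"
  \<comment> \<open>Two errors add up: at most a \<open>2 * ?\<eta>\<close> fraction of rows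
    deviates from \<open>z y\<close>, each by at most \<open>2 * (G + 1)\<close>, which costs
    \<open>\<epsilon>\<close>; replacing entries by inner products costs \<open>e\<close>.\<close>
  have close: "\<bar>z y - ip d ?w (v y)\<bar> \<le> e + \<epsilon>" if y: "y < n" for y
  proof -
    have 1: "\<bar>\<Sum>x\<in>R. real_of_int (z y) - Z x y\<bar> \<le> card {x\<in>R. Z x y \<noteq> z y} * (2 * (G + 1))"
    proof -
      have "(\<Sum>x\<in>R. real_of_int (z y) - Z x y) = (\<Sum>x\<in>{x\<in>R. Z x y \<noteq> z y}. real_of_int (z y) - Z x y)"
        using finR by (intro sum.mono_neutral_right) auto
      also have "\<bar>\<dots>\<bar> \<le> (\<Sum>x\<in>{x\<in>R. Z x y \<noteq> z y}. \<bar>real_of_int (z y) - Z x y\<bar>)" by (rule sum_abs)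
      also have "\<dots> \<le> card {x\<in>R. Z x y \<noteq> z y} * (2 * (G + 1))"
      proof (rule sum_bounded_above)
        fix x assume "x \<in> {x\<in>R. Z x y \<noteq> z y}"
        then show "\<bar>real_of_int (z y) - Z x y\<bar> \<le> 2 * (G + 1)" using ZG[of x y] zG[OF y] y by force
      qed
      finally show ?thesis .
    qed
    have "card {x\<in>R. Z x y \<noteq> z y} * (2 * (G + 1)) \<le> (2 * ?\<eta> * card R) * (2 * (G + 1))"
      using z[OF y] G by (intro mult_right_mono) auto
    also have "\<dots> = card R * (4 * ?\<eta> * (G + 1))" by simp
    also have "\<dots> \<le> card R * \<epsilon>" using \<beta>(2) by (intro mult_left_mono) auto
    finally have 3: "\<bar>\<Sum>x\<in>R. real_of_int (z y) - Z x y\<bar> \<le> card R * \<epsilon>" using 1 by linarith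
    have "\<bar>\<Sum>x\<in>R. Z x y - ip d (u x) (v y)\<bar> \<le> (\<Sum>x\<in>R. \<bar>Z x y - ip d (u x) (v y)\<bar>)" by (rule sum_abs)
    also have "\<dots> \<le> card R * e" using Z R(1) y by (intro sum_bounded_above) auto
    finally have 2: "\<bar>\<Sum>x\<in>R. Z x y - ip d (u x) (v y)\<bar> \<le> card R * e" .
    have "(\<Sum>x\<in>R. ip d (u x) (v y)) = card R * ip d ?w (v y)" using cR by (simp add: ip_mean)
    then have "card R * (z y - ip d ?w (v y))
      = (\<Sum>x\<in>R. real_of_int (z y) - Z x y) + (\<Sum>x\<in>R. Z x y - ip d (u x) (v y))"
      by (simp add: sum_subtractf right_diff_distrib)
    then have "\<bar>card R * (z y - ip d ?w (v y))\<bar> \<le> card R * (e + \<epsilon>)"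
      using 3 2 by (simp add: distrib_left)
    then show ?thesis using cR by (simp add: abs_mult)
  qed
  define W where "W = ip d ?w ?w"
  \<comment> \<open>A nonzero integer \<open>z y0\<close> within \<open>1 / 8\<close> of the inner
    product makes the latter at least \<open>7 / 8\<close> in absolute value, and
    \<open>(7 / 8)\<^sup>2 \<ge> 9 / 16\<close>.\<close>
  have W: "9 / 16 \<le> W"
  proof -
    obtain x where "x \<in> R" "Z x y0 = z y0" using attained[OF y0(1)] by blast
    then have "z y0 \<noteq> 0" using y0(2)[of x] R(1) by auto
    then have "1 \<le> \<bar>real_of_int (z y0)\<bar>" by linarith
    then have "7 / 8 \<le> \<bar>ip d ?w (v y0)\<bar>" using close[OF y0(1)] e(2) by linarith
    then have "(7 / 8)\<^sup>2 \<le> \<bar>ip d ?w (v y0)\<bar>\<^sup>2" by (intro power_mono) auto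
    also have "\<dots> \<le> W * ip d (v y0) (v y0)" using ip_Cauchy_Schwarz[of d ?w] unfolding W_def by simp
    also have "\<dots> \<le> W * 1" using v[OF y0(1)] ip_self_nonneg unfolding W_def by (intro mult_left_mono) auto
    finally show ?thesis by (simp add: power2_eq_square)
  qed
  have upper: "ip d (u x) ?w \<le> 4 / 3 * G * W" if "x \<in> R" for x
  proof (rule power2_le_imp_le)
    have "(ip d (u x) ?w)\<^sup>2 \<le> ip d (u x) (u x) * W" unfolding W_def by (rule ip_Cauchy_Schwarz)
    also have "\<dots> \<le> G\<^sup>2 * W" using u[of x] that R(1) E W by (intro mult_right_mono) auto
    also have "\<dots> \<le> G\<^sup>2 * (16 / 9 * W * W)"
      using W by (intro mult_left_mono mult_right_mono[of 1 "16 / 9 * W" W, simplified]) auto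
    also have "\<dots> = (4 / 3 * G * W)\<^sup>2" by (simp add: power2_eq_square)
    finally show "(ip d (u x) ?w)\<^sup>2 \<le> (4 / 3 * G * W)\<^sup>2" .
  qed (use G W in auto)
  have PR: "P R \<subseteq> R" unfolding P_def by auto
  \<comment> \<open>Averaging: the products with the mean average to \<open>W\<close>. Those outside
    \<open>P R\<close> are below \<open>3 / 4 * W\<close>, all others at most
    \<open>4 / 3 * G * W\<close>, so \<open>P R\<close> has density at least
    \<open>(1 / 4) / (4 / 3 * G)\<close>.\<close>
  have "card R * W = (\<Sum>x\<in>R. ip d (u x) ?w)" using cR unfolding W_def by (subst ip_mean) simp
  also have "\<dots> = (\<Sum>x\<in>R - P R. ip d (u x) ?w) + (\<Sum>x\<in>P R. ip d (u x) ?w)"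
    by (rule sum.subset_diff[OF PR finR])
  also have "\<dots> \<le> (\<Sum>x\<in>R - P R. 3 / 4 * W) + card (P R) * (4 / 3 * G * W)"
    using upper PR by (intro add_mono sum_mono sum_bounded_above) (auto simp: P_def W_def)
  also have "\<dots> \<le> (\<Sum>x\<in>R. 3 / 4 * W) + card (P R) * (4 / 3 * G * W)"
    using finR W by (intro add_right_mono sum_mono2) auto
  also have "\<dots> = (3 / 4 * card R + card (P R) * (4 / 3 * G)) * W" by (simp add: algebra_simps)
  finally have "card R \<le> 3 / 4 * card R + card (P R) * (4 / 3 * G)" using W by simp
  then have dense: "3 / (16 * G) * card R \<le> card (P R)" using G by (simp add: field_simps)
  \<comment> \<open>The new squared norm is at most
    \<open>E - 2 * (3 / 4) * W + W = E - W / 2\<close>, and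
    \<open>W / 2 \<ge> 9 / 32\<close>.\<close>
  have drop: "ip d (\<lambda>k. u x k - ?w k) (\<lambda>k. u x k - ?w k) \<le> E - 1 / 4" if "x \<in> P R" for x
  proof -
    have "ip d (u x) (u x) \<le> E" "3 / 4 * W \<le> ip d (u x) ?w"
      using that u R(1) unfolding P_def W_def by auto
    then show ?thesis using W unfolding ip_diff_self W_def[symmetric] by linarith
  qed
  show ?thesis
    by (intro exI[of _ R] exI[of _ z] conjI allI impI ballI R(1) large dense half close zG drop)
qed

text \<open>The greedy pieces of the column supports each have a common nonzero column, so
  \<open>cluster_around_mean\<close> applies inside each. Subtracting means from \<open>u\<close>
  and their roundings \<open>z\<close> from \<open>Z\<close> adds \<open>e + \<epsilon>\<close> to
  the error \<open>e\<close>. The bound \<open>s\<close> counts the clusters with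
  \<open>z i y \<noteq> 0\<close> for one column \<open>y\<close>.\<close>

lemma cluster_subtraction:
  fixes Z :: "nat \<Rightarrow> nat \<Rightarrow> int" and g s :: nat and G :: real
  assumes S: "S \<subseteq> {..<m}" and nonzero: "\<And>x. x \<in> S \<Longrightarrow> \<exists>y<n. Z x y \<noteq> 0"
    and u: "\<And>x. x \<in> S \<Longrightarrow> ip d (u x) (u x) \<le> E" and E: "E \<le> G\<^sup>2" and G: "1 \<le> G"
    and v: "\<And>y. y < n \<Longrightarrow> ip d (v y) (v y) \<le> 1"
    and Z: "\<And>x y. x \<in> S \<Longrightarrow> y < n \<Longrightarrow> \<bar>Z x y - ip d (u x) (v y)\<bar> \<le> e"
    and \<beta>: "0 \<le> \<beta>" "4 * exp (1 - \<beta> / 8) * (G + 1) \<le> \<epsilon>" and e: "0 \<le> e" "e + \<epsilon> \<le> 1 / 8"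
    and g: "G + 1 \<le> g" and s: "1 + 2 * exp (\<beta> * G\<^sup>2) * ln m \<le> s"
  shows "\<exists>S' u' Z'. S' \<subseteq> S \<and> 3 / (16 * G) * exp (- \<beta> * G\<^sup>2) * card S \<le> card S' \<and>
    (\<forall>x\<in>S'. ip d (u' x) (u' x) \<le> E - 1 / 4) \<and>
    (\<forall>x\<in>S'. \<forall>y<n. \<bar>Z' x y - ip d (u' x) (v y)\<bar> \<le> 2 * e + \<epsilon>) \<and>
    signed_blocky_sum m n (s * (g * 2)) (restrict_rows S' (\<lambda>x y. Z x y - Z' x y))"
proof -
  have finS: "finite S" using S finite_subset by blast
  define F where "F y = {x. Z x y \<noteq> 0}" for y
  have "S \<subseteq> (\<Union>y\<in>{..<n}. F y)" using nonzero unfolding F_def by auto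
  from greedy_disjoint_cover[OF finS finite_lessThan this] obtain N :: nat and T f where
    T1: "\<forall>i<N. T i \<noteq> {} \<and> T i \<subseteq> F (f i) \<and> f i \<in> {..<n}" and
    T2: "\<forall>i<N. \<forall>j<N. i \<noteq> j \<longrightarrow> T i \<inter> T j = {}" and
    T3: "(\<Union>i<N. T i) = S" and
    T4: "\<forall>y\<in>{..<n}. \<forall>i<N. (\<Sum>j=i..<N. card (F y \<inter> T j)) \<le> card (T i)"
    by (elim exE conjE) (rule that; assumption)
  have TS: "T i \<subseteq> S" if "i < N" for i using T3 that by blast
  have finT: "finite (T i)" if "i < N" for i using TS[OF that] finS finite_subset by blast
  define P where "P R = {x\<in>R. 3 / 4 * ip d (mean u R) (mean u R) \<le> ip d (u x) (mean u R)}" for R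
  define good where "good i R z \<longleftrightarrow> R \<subseteq> T i \<and> exp (- \<beta> * G\<^sup>2) * card (T i) \<le> card R \<and>
    3 / (16 * G) * card R \<le> card (P R) \<and>
    (\<forall>y<n. 2 * card {x\<in>R. Z x y \<noteq> z y} \<le> card R) \<and>
    (\<forall>y<n. \<bar>z y - ip d (mean u R) (v y)\<bar> \<le> e + \<epsilon>) \<and>
    (\<forall>y<n. \<bar>real_of_int (z y)\<bar> \<le> G + 1) \<and>
    (\<forall>x\<in>P R. ip d (\<lambda>k. u x k - mean u R k) (\<lambda>k. u x k - mean u R k) \<le> E - 1 / 4)" for i R z
  have "\<forall>i\<in>{..<N}. \<exists>R z. good i R z"
  proof
    fix i assume "i \<in> {..<N}"
    then have i: "i < N" by simp
    have fi: "f i < n" and Zf: "\<And>x. x \<in> T i \<Longrightarrow> Z x (f i) \<noteq> 0" using T1 i unfolding F_def by auto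
    show "\<exists>R z. good i R z"
      unfolding good_def P_def
    proof (rule cluster_around_mean[where T = "T i" and u = u and d = d and v = v and Z = Z and n = n,
          OF finT[OF i] _ fi Zf])
      show "T i \<noteq> {}" using T1 i by blast
      show "ip d (u x) (u x) \<le> E" if "x \<in> T i" for x using u TS[OF i] that by blast
      show "\<bar>Z x y - ip d (u x) (v y)\<bar> \<le> e" if "x \<in> T i" "y < n" for x y
        using Z TS[OF i] that by blast
    qed (use E G v \<beta> e in auto)
  qed
  from bchoice[OF this] obtain R where "\<forall>i\<in>{..<N}. \<exists>z. good i (R i) z" ..
  from bchoice[OF this] obtain z where "\<forall>i\<in>{..<N}. good i (R i) (z i)" ..
  then have good: "good i (R i) (z i)" if "i < N" for i using that by simp
  define D where "D i = P (R i)" for i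
  have DT: "D i \<subseteq> T i" if "i < N" for i using good[OF that] unfolding good_def D_def P_def by blast
  have Ddisj: "D i \<inter> D j = {}" if "i < N" "j < N" "i \<noteq> j" for i j
    using T2 DT[OF that(1)] DT[OF that(2)] that by blast
  have finD: "finite (D i)" if "i < N" for i using DT[OF that] finT[OF that] finite_subset by blast
  define S' where "S' = (\<Union>i<N. D i)"
  \<comment> \<open>The sets \<open>D i\<close> are disjoint, so at most one summand is
    nonzero.\<close>
  define u' where "u' x k = u x k - (\<Sum>i<N. if x \<in> D i then mean u (R i) k else 0)" for x k
  define Z' where "Z' x y = Z x y - (\<Sum>i<N. if x \<in> D i then z i y else 0)" for x y
  have u'_eq: "u' x = (\<lambda>k. u x k - mean u (R i) k)" if "i < N" "x \<in> D i" for i x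
    unfolding u'_def using that Ddisj by (subst sum_if_disjoint[of N D i x]) auto
  have Z'_eq: "Z' x y = Z x y - z i y" if "i < N" "x \<in> D i" for i x y
    unfolding Z'_def using that Ddisj by (subst sum_if_disjoint[of N D i x]) auto
  have S'S: "S' \<subseteq> S" unfolding S'_def using DT TS by blast
  have cardS': "3 / (16 * G) * exp (- \<beta> * G\<^sup>2) * card S \<le> card S'"
  proof -
    have "card S = (\<Sum>i<N. card (T i))"
      unfolding T3[symmetric] using T2 finT by (intro card_UN_disjoint) auto
    then have "3 / (16 * G) * exp (- \<beta> * G\<^sup>2) * card S
        = (\<Sum>i<N. 3 / (16 * G) * (exp (- \<beta> * G\<^sup>2) * card (T i)))"
      by (simp add: sum_distrib_left mult.assoc)
    also have "\<dots> \<le> (\<Sum>i<N. real (card (D i)))"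
    proof (rule sum_mono)
      fix i assume "i \<in> {..<N}"
      then have "good i (R i) (z i)" using good by simp
      then have 1: "exp (- \<beta> * G\<^sup>2) * card (T i) \<le> card (R i)"
        and 2: "3 / (16 * G) * card (R i) \<le> card (D i)" unfolding good_def D_def by auto
      have "3 / (16 * G) * (exp (- \<beta> * G\<^sup>2) * card (T i)) \<le> 3 / (16 * G) * card (R i)"
        using 1 G by (intro mult_left_mono) auto
      then show "3 / (16 * G) * (exp (- \<beta> * G\<^sup>2) * card (T i)) \<le> card (D i)" using 2 by linarith
    qed
    also have "\<dots> = card S'"
      unfolding S'_def using Ddisj finD by (subst card_UN_disjoint) auto
    finally show ?thesis .
  qed
  have energy: "ip d (u' x) (u' x) \<le> E - 1 / 4" if x: "x \<in> S'" for x
  proof -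
    obtain i where i: "i < N" "x \<in> D i" using x unfolding S'_def by auto
    show ?thesis using good[OF i(1)] i(2) unfolding u'_eq[OF i] good_def D_def by blast
  qed
  have error: "\<bar>Z' x y - ip d (u' x) (v y)\<bar> \<le> 2 * e + \<epsilon>" if x: "x \<in> S'" and y: "y < n" for x y
  proof -
    obtain i where i: "i < N" "x \<in> D i" using x unfolding S'_def by auto
    have "\<bar>z i y - ip d (mean u (R i)) (v y)\<bar> \<le> e + \<epsilon>"
      using good[OF i(1)] y unfolding good_def by blast
    moreover have "\<bar>Z x y - ip d (u x) (v y)\<bar> \<le> e" using Z S'S x y by blast
    moreover have "real_of_int (Z' x y) - ip d (u' x) (v y)
        = (Z x y - ip d (u x) (v y)) - (z i y - ip d (mean u (R i)) (v y))"
      unfolding u'_eq[OF i] Z'_eq[OF i] ip_diff_left by simp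
    ultimately show ?thesis by linarith
  qed
  have sparse: "card {i. i < N \<and> z i y \<noteq> 0} \<le> s" if y: "y < n" for y
  proof (cases "{i. i < N \<and> z i y \<noteq> 0} = {}")
    case True
    show ?thesis unfolding True by simp
  next
    case False
    define I where "I = {i. i < N \<and> z i y \<noteq> 0}"
    have I: "finite I" "I \<noteq> {}" "I \<subseteq> {..<N}" using False unfolding I_def by auto
    \<comment> \<open>The cluster \<open>R j\<close> is an
      \<open>exp (- \<beta> * G\<^sup>2)\<close> fraction of \<open>T j\<close>, and column
      \<open>y\<close> equals \<open>z j y \<noteq> 0\<close> on at least half of it.\<close>
    define \<kappa> where "\<kappa> = exp (- \<beta> * G\<^sup>2) / 2"
    have mass: "\<kappa> * card (T j) \<le> card (F y \<inter> T j)" if "j \<in> I" for j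
    proof -
      have j: "j < N" "z j y \<noteq> 0" using that unfolding I_def by auto
      note gj = good[OF j(1), unfolded good_def]
      have finR: "finite (R j)" using gj finT[OF j(1)] finite_subset by blast
      have "{x\<in>R j. Z x y = z j y} \<subseteq> F y \<inter> T j" using gj j(2) unfolding F_def by auto
      then have 1: "card {x\<in>R j. Z x y = z j y} \<le> card (F y \<inter> T j)"
        using finT[OF j(1)] by (intro card_mono) auto
      have "card ({x\<in>R j. Z x y = z j y} \<union> {x\<in>R j. Z x y \<noteq> z j y})
          = card {x\<in>R j. Z x y = z j y} + card {x\<in>R j. Z x y \<noteq> z j y}"
        using finR by (intro card_Un_disjoint) auto
      moreover have "{x\<in>R j. Z x y = z j y} \<union> {x\<in>R j. Z x y \<noteq> z j y} = R j" by auto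
      ultimately have 2: "card (R j) = card {x\<in>R j. Z x y = z j y} + card {x\<in>R j. Z x y \<noteq> z j y}"
        by simp
      have 3: "2 * card {x\<in>R j. Z x y \<noteq> z j y} \<le> card (R j)" using gj y by blast
      have 4: "exp (- \<beta> * G\<^sup>2) * card (T j) \<le> card (R j)" using gj by blast
      have "\<kappa> * card (T j) \<le> card (R j) / 2" using 4 unfolding \<kappa>_def by simp
      then show ?thesis using 1 2 3 by linarith
    qed
    have "\<kappa> * (real (card I) - 1) \<le> ln (\<Sum>i\<in>I. real (card (T i)))"
    proof (rule card_le_of_geometric_tails[OF I(1,2)])
      show "0 < \<kappa>" unfolding \<kappa>_def by simp
      fix i assume i: "i \<in> I"
      then have iN: "i < N" using I(3) by auto
      have "0 < card (T i)" using T1 iN finT[OF iN] by (simp add: card_gt_0_iff)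
      then show "1 \<le> real (card (T i))" by simp
      \<comment> \<open>Each later piece gives the support of column \<open>y\<close> a
        \<open>\<kappa>\<close> fraction of itself, but by greediness that support meets all pieces
        from \<open>i\<close> on in at most \<open>card (T i)\<close> rows. Hence the sizes satisfy
        the geometric tail condition.\<close>
      have "\<kappa> * (\<Sum>j\<in>{j\<in>I. i \<le> j}. real (card (T j))) \<le> (\<Sum>j\<in>{j\<in>I. i \<le> j}. real (card (F y \<inter> T j)))"
        unfolding sum_distrib_left by (intro sum_mono mass) auto
      also have "\<dots> \<le> (\<Sum>j=i..<N. real (card (F y \<inter> T j)))"
        using I(3) by (intro sum_mono2) auto
      also have "\<dots> = real (\<Sum>j=i..<N. card (F y \<inter> T j))" by simp
      also have "\<dots> \<le> real (card (T i))" using T4 y iN by (subst of_nat_le_iff) auto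
      finally show "\<kappa> * (\<Sum>j\<in>{j\<in>I. i \<le> j}. real (card (T j))) \<le> real (card (T i))" .
    qed
    also have "\<dots> \<le> ln m"
    proof -
      have "(\<Sum>i\<in>I. card (T i)) \<le> (\<Sum>i<N. card (T i))" using I(3) by (intro sum_mono2) auto
      also have "\<dots> = card S" unfolding T3[symmetric] using T2 finT by (intro card_UN_disjoint[symmetric]) auto
      also have "\<dots> \<le> m" using card_mono[OF _ S] by simp
      finally have le: "(\<Sum>i\<in>I. card (T i)) \<le> m" .
      obtain i where i: "i \<in> I" using I(2) by auto
      then have iN: "i < N" using I(3) by auto
      have "0 < card (T i)" using T1 iN finT[OF iN] by (simp add: card_gt_0_iff)
      also have "\<dots> \<le> (\<Sum>i\<in>I. card (T i))" using I(1) i by (intro member_le_sum) auto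
      finally have "0 < (\<Sum>i\<in>I. card (T i))" .
      then show ?thesis using le by (subst ln_le_cancel_iff) (auto simp flip: of_nat_sum)
    qed
    finally have "real (card I) - 1 \<le> 2 * exp (\<beta> * G\<^sup>2) * ln m"
      unfolding \<kappa>_def by (simp add: exp_minus field_simps)
    then show ?thesis using s unfolding I_def by linarith
  qed
  have "signed_blocky_sum m n (s * (g * 2)) (\<lambda>x y. \<Sum>i<N. if x \<in> D i then z i y else 0)"
  proof (rule signed_blocky_sum_row_clusters[OF _ Ddisj _ sparse])
    fix i assume i: "i < N"
    show "D i \<subseteq> {..<m}" using DT[OF i] TS[OF i] S by blast
    fix y assume "y < n"
    then have "\<bar>real_of_int (z i y)\<bar> \<le> G + 1" using good[OF i] unfolding good_def by blast
    then show "\<bar>z i y\<bar> \<le> int g" using g by linarith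
  qed
  then have "signed_blocky_sum m n (s * (g * 2)) (restrict_rows S' (\<lambda>x y. Z x y - Z' x y))"
  proof (rule signed_blocky_sum_cong)
    fix x y
    show "restrict_rows S' (\<lambda>x y. Z x y - Z' x y) x y = (\<Sum>i<N. if x \<in> D i then z i y else 0)"
    proof (cases "x \<in> S'")
      case True
      then show ?thesis by (simp add: restrict_rows_def Z'_def)
    next
      case False
      then have "\<forall>i<N. x \<notin> D i" unfolding S'_def by auto
      then show ?thesis using False by (simp add: restrict_rows_def)
    qed
  qed
  then show ?thesis
    by (intro exI[of _ S'] exI[of _ u'] exI[of _ Z'] conjI ballI allI impI S'S cardS' energy error)
qed

section \<open>Iterating the decrement and exhausting the rows\<close>

text \<open>Induction on the number \<open>j\<close> of rounds still available: each lowers the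
  squared norm bound by \<open>1 / 4\<close>, so \<open>E < j / 4\<close> persists, and
  \<open>j = 0\<close> would give a negative squared norm. Rows that already vanish are set aside,
  since \<open>cluster_subtraction\<close> needs a nonzero entry in every row.\<close>

lemma large_row_set_signed_blocky_sum:
  fixes Z :: "nat \<Rightarrow> nat \<Rightarrow> int" and g s :: nat and G :: real
  assumes G: "1 \<le> G" and v: "\<And>y. y < n \<Longrightarrow> ip d (v y) (v y) \<le> 1"
    and \<beta>: "0 \<le> \<beta>" "4 * exp (1 - \<beta> / 8) * (G + 1) \<le> \<epsilon>"
    and g: "G + 1 \<le> g" and s: "1 + 2 * exp (\<beta> * G\<^sup>2) * ln m \<le> s"
    and S: "S \<subseteq> {..<m}" "S \<noteq> {}"
    and u: "\<And>x. x \<in> S \<Longrightarrow> ip d (u x) (u x) \<le> E" and E: "E \<le> G\<^sup>2" "E < j / 4"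
    and Z: "\<And>x y. x \<in> S \<Longrightarrow> y < n \<Longrightarrow> \<bar>Z x y - ip d (u x) (v y)\<bar> \<le> e"
    and e: "0 \<le> e" "(e + \<epsilon>) * 2 ^ j \<le> 1 / 8"
  shows "\<exists>R\<subseteq>S. (3 / (32 * G) * exp (- \<beta> * G\<^sup>2)) ^ j * card S \<le> card R \<and>
    signed_blocky_sum m n (j * (s * (g * 2))) (restrict_rows R Z)"
  using S u E Z e
proof (induction j arbitrary: S u Z E e)
  case 0
  then obtain x where "x \<in> S" by auto
  then have "ip d (u x) (u x) < 0" using "0.prems"(3)[of x] "0.prems"(5) by simp
  then show ?case using ip_self_nonneg[of d "u x"] by simp
next
  case (Suc j)
  \<comment> \<open>Half the density from \<open>cluster_subtraction\<close>: either at least half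
    of the rows vanish and are taken at once, or the nonzero rows \<open>S1\<close> form at least
    half of \<open>S\<close>.\<close>
  define r where "r = 3 / (32 * G) * exp (- \<beta> * G\<^sup>2)"
  have "exp (- \<beta> * G\<^sup>2) \<le> 1" using \<beta>(1) by simp
  moreover have "3 / (32 * G) \<le> 1 / 2" using G by (simp add: field_simps)
  ultimately have "r \<le> 1 / 2 * 1" unfolding r_def using G by (intro mult_mono) auto
  then have r: "0 < r" "r \<le> 1 / 2" using G unfolding r_def by auto
  have rj: "r ^ j \<le> 1" using r by (intro power_le_one) auto
  have finS: "finite S" using Suc.prems(1) finite_subset by blast
  have "0 \<le> 4 * exp (1 - \<beta> / 8) * (G + 1)" using G by simp
  then have \<epsilon>: "0 \<le> \<epsilon>" using \<beta>(2) by linarith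
  define S0 where "S0 = {x\<in>S. \<forall>y<n. Z x y = 0}"
  show ?case
  proof (cases "card S \<le> 2 * card S0")
    case True
    have "r * r ^ j \<le> 1 / 2 * 1" using r rj by (intro mult_mono) auto
    then have "r ^ Suc j * card S \<le> 1 / 2 * card S" by (intro mult_right_mono) auto
    also have "\<dots> \<le> card S0" using True by simp
    finally have "r ^ Suc j * card S \<le> card S0" .
    moreover have "signed_blocky_sum m n (Suc j * (s * (g * 2))) (restrict_rows S0 Z)"
      by (rule signed_blocky_sum_cong[OF signed_blocky_sum_zero]) (simp add: restrict_rows_def S0_def)
    moreover have "S0 \<subseteq> S" unfolding S0_def by auto
    ultimately show ?thesis unfolding r_def by blast
  next
    case False
    define S1 where "S1 = S - S0"
    have S1: "S1 \<subseteq> S" unfolding S1_def by auto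
    have "card S1 = card S - card S0"
      unfolding S1_def using finS by (intro card_Diff_subset) (auto simp: S0_def)
    then have cS1: "card S \<le> 2 * card S1" using False by linarith
    have small: "e + \<epsilon> \<le> 1 / 8"
    proof -
      have "e + \<epsilon> \<le> (e + \<epsilon>) * 2 ^ Suc j"
        using Suc.prems(7) \<epsilon> mult_left_mono[OF one_le_power[of "2::real" "Suc j"], of "e + \<epsilon>"] by simp
      also have "\<dots> \<le> 1 / 8" by (rule Suc.prems(8))
      finally show ?thesis .
    qed
    have "\<exists>S' u' Z'. S' \<subseteq> S1 \<and> 3 / (16 * G) * exp (- \<beta> * G\<^sup>2) * card S1 \<le> card S' \<and>
      (\<forall>x\<in>S'. ip d (u' x) (u' x) \<le> E - 1 / 4) \<and>
      (\<forall>x\<in>S'. \<forall>y<n. \<bar>Z' x y - ip d (u' x) (v y)\<bar> \<le> 2 * e + \<epsilon>) \<and>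
      signed_blocky_sum m n (s * (g * 2)) (restrict_rows S' (\<lambda>x y. Z x y - Z' x y))"
    proof (rule cluster_subtraction[where u = u and d = d and v = v and Z = Z and n = n and m = m and S = S1,
          OF _ _ _ Suc.prems(4) G v _ \<beta> Suc.prems(7) small g s])
      show "S1 \<subseteq> {..<m}" using S1 Suc.prems(1) by blast
      show "\<exists>y<n. Z x y \<noteq> 0" if "x \<in> S1" for x using that unfolding S1_def S0_def by auto
      show "ip d (u x) (u x) \<le> E" if "x \<in> S1" for x using that S1 Suc.prems(3) by blast
      show "\<bar>Z x y - ip d (u x) (v y)\<bar> \<le> e" if "x \<in> S1" "y < n" for x y
        using that S1 Suc.prems(6) by blast
    qed
    then obtain S' u' Z' where S': "S' \<subseteq> S1" "3 / (16 * G) * exp (- \<beta> * G\<^sup>2) * card S1 \<le> card S'"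
      "\<forall>x\<in>S'. ip d (u' x) (u' x) \<le> E - 1 / 4"
      "\<forall>x\<in>S'. \<forall>y<n. \<bar>Z' x y - ip d (u' x) (v y)\<bar> \<le> 2 * e + \<epsilon>"
      "signed_blocky_sum m n (s * (g * 2)) (restrict_rows S' (\<lambda>x y. Z x y - Z' x y))"
      by (elim exE conjE) (rule that; assumption)
    have "r * card S \<le> r * (2 * card S1)" using cS1 r by (intro mult_left_mono) auto
    also have "\<dots> \<le> card S'" using S'(2) unfolding r_def by (simp add: field_simps)
    finally have cS': "r * card S \<le> card S'" .
    moreover have "0 < r * card S" using r finS Suc.prems(2) by (simp add: card_gt_0_iff)
    ultimately have "S' \<noteq> {}" by auto
    have "\<exists>R\<subseteq>S'. r ^ j * card S' \<le> card R \<and>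
        signed_blocky_sum m n (j * (s * (g * 2))) (restrict_rows R Z')"
      unfolding r_def
    proof (rule Suc.IH[where u = u' and E = "E - 1 / 4" and e = "2 * e + \<epsilon>"])
      show "S' \<subseteq> {..<m}" using S'(1) S1 Suc.prems(1) by blast
      show "E - 1 / 4 < real j / 4" using Suc.prems(5) by simp
      \<comment> \<open>The new error satisfies
        \<open>(2 * e + \<epsilon>) + \<epsilon> = 2 * (e + \<epsilon>)\<close>, so the error budget
        is exactly preserved when one power of 2 is used up.\<close>
      show "(2 * e + \<epsilon> + \<epsilon>) * 2 ^ j \<le> 1 / 8" using Suc.prems(8) by (simp add: algebra_simps)
    qed (use S' \<open>S' \<noteq> {}\<close> Suc.prems(4,7) \<epsilon> in auto)
    then obtain R where R: "R \<subseteq> S'" "r ^ j * card S' \<le> card R"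
      "signed_blocky_sum m n (j * (s * (g * 2))) (restrict_rows R Z')" by blast
    have "r ^ Suc j * card S = r ^ j * (r * card S)" by simp
    also have "\<dots> \<le> r ^ j * card S'" using cS' r by (intro mult_left_mono) auto
    also have "\<dots> \<le> card R" by (rule R(2))
    finally have "r ^ Suc j * card S \<le> card R" .
    moreover have "signed_blocky_sum m n (Suc j * (s * (g * 2))) (restrict_rows R Z)"
    proof (rule signed_blocky_sum_cong)
      show "signed_blocky_sum m n (Suc j * (s * (g * 2)))
        (\<lambda>x y. restrict_rows R (restrict_rows S' (\<lambda>x y. Z x y - Z' x y)) x y + restrict_rows R Z' x y)"
        using signed_blocky_sum_add[OF signed_blocky_sum_restrict_rows[OF S'(5), of R] R(3)] by simp
      show "restrict_rows R Z x y
        = restrict_rows R (restrict_rows S' (\<lambda>x y. Z x y - Z' x y)) x y + restrict_rows R Z' x y" for x y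
        using R(1) by (auto simp: restrict_rows_def)
    qed
    moreover have "R \<subseteq> S" using R(1) S'(1) S1 by blast
    ultimately show ?thesis unfolding r_def by blast
  qed
qed

text \<open>Each round removes at least a \<open>\<delta>\<close> fraction of the remaining rows;
  after \<open>t\<close> rounds fewer than one row, hence none, is left.\<close>

lemma signed_blocky_sum_peel_rows:
  fixes \<delta> :: real
  assumes "\<And>S. S \<subseteq> {..<m} \<Longrightarrow> S \<noteq> {} \<Longrightarrow>
      \<exists>R\<subseteq>S. \<delta> * card S \<le> card R \<and> signed_blocky_sum m n L (restrict_rows R A)"
    and "S \<subseteq> {..<m}" "\<delta> \<le> 1" "(1 - \<delta>) ^ t * card S < 1"
  shows "signed_blocky_sum m n (t * L) (restrict_rows S A)"
  using assms(2,4)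
proof (induction t arbitrary: S)
  case 0
  then have "card S = 0" by simp
  then have "S = {}" using finite_subset[OF "0.prems"(1)] by simp
  then show ?case by (simp add: restrict_rows_def signed_blocky_sum_zero)
next
  case (Suc t)
  show ?case
  proof (cases "S = {}")
    case True
    then show ?thesis by (simp add: restrict_rows_def signed_blocky_sum_zero)
  next
    case False
    from assms(1)[OF Suc.prems(1) False] obtain R where R: "R \<subseteq> S" "\<delta> * card S \<le> card R"
      "signed_blocky_sum m n L (restrict_rows R A)" by blast
    have finS: "finite S" using Suc.prems(1) finite_subset by blast
    have "real (card (S - R)) = real (card S) - real (card R)"
      using R(1) finS by (simp add: card_Diff_subset finite_subset card_mono of_nat_diff)
    also have "\<dots> \<le> (1 - \<delta>) * card S" using R(2) by (simp add: algebra_simps)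
    finally have "(1 - \<delta>) ^ t * card (S - R) \<le> (1 - \<delta>) ^ t * ((1 - \<delta>) * card S)"
      using assms(3) by (intro mult_left_mono) auto
    also have "\<dots> < 1" using Suc.prems(2) by (simp add: mult_ac)
    finally have "signed_blocky_sum m n (t * L) (restrict_rows (S - R) A)"
      using Suc.prems(1) by (intro Suc.IH) auto
    note rest = this
    show ?thesis
    proof (rule signed_blocky_sum_cong)
      show "signed_blocky_sum m n (Suc t * L) (\<lambda>x y. restrict_rows R A x y + restrict_rows (S - R) A x y)"
        using signed_blocky_sum_add[OF R(3) rest] by simp
      show "restrict_rows S A x y = restrict_rows R A x y + restrict_rows (S - R) A x y" for x y
        using R(1) by (auto simp: restrict_rows_def)
    qed
  qed
qed

section \<open>The bound\<close>

lemma signed_blocky_sum_of_normalized_factorization: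
  fixes G :: real
  assumes m: "2 \<le> m" and G: "1 \<le> G"
    and u: "\<And>x. x < m \<Longrightarrow> ip d (u x) (u x) \<le> G\<^sup>2"
    and v: "\<And>y. y < n \<Longrightarrow> ip d (v y) (v y) \<le> 1"
    and A: "\<And>x y. x < m \<Longrightarrow> y < n \<Longrightarrow> real_of_int (A x y) = ip d (u x) (v y)"
  shows "\<exists>L. signed_blocky_sum m n L A \<and> real L \<le> exp (1000 * G ^ 6) * (ln m)\<^sup>2"
proof -
  \<comment> \<open>\<open>J\<close> rounds exhaust a squared norm of \<open>G\<^sup>2\<close> at
    \<open>1 / 4\<close> per round. \<open>\<epsilon>\<close> is \<open>1 / 8\<close> shared among
    \<open>J\<close> doublings, and \<open>\<beta>\<close> is large enough that
    \<open>exp (1 - \<beta> / 8)\<close> beats \<open>2 ^ J * (G + 1)\<close>. The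
    \<open>+ 1\<close> in \<open>t\<close> makes \<open>l / \<delta> < t\<close> strict, as needed
    to get below one row.\<close>
  define J where "J = nat \<lfloor>4 * G\<^sup>2\<rfloor> + 1"
  define \<epsilon> :: real where "\<epsilon> = 1 / (8 * 2 ^ J)"
  define \<beta> where "\<beta> = 128 * G\<^sup>2"
  define g where "g = nat \<lceil>G + 1\<rceil>"
  define l where "l = ln (real m)"
  define s where "s = nat \<lceil>1 + 2 * exp (\<beta> * G\<^sup>2) * l\<rceil>"
  define \<delta> where "\<delta> = (3 / (32 * G) * exp (- \<beta> * G\<^sup>2)) ^ J"
  define t where "t = nat \<lceil>l / \<delta>\<rceil> + 1"
  define Q where "Q = G ^ 6"
  have pw: "G \<le> G\<^sup>2" "G\<^sup>2 \<le> G ^ 4" "G ^ 4 \<le> Q" "1 \<le> G\<^sup>2" "G \<le> Q" "1 \<le> Q"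
    unfolding Q_def using G power_increasing[of 1 2 G] power_increasing[of 2 4 G]
      power_increasing[of 4 6 G] power_increasing[of 0 2 G] power_increasing[of 1 6 G]
      power_increasing[of 0 6 G] by simp_all
  have GE: "G \<le> exp G" using exp_ge_add_one_self[of G] by linarith
  have two: "2 \<le> exp (1::real)" using exp_ge_add_one_self[of "1::real"] by simp
  have two_pow: "2 ^ k \<le> exp (real k)" for k :: nat
    using power_mono[OF two, of k] exp_of_nat_mult[of k "1::real"] by simp
  have "ln (1 / 2) \<le> (1 / 2 - 1 :: real)" by (rule ln_le_minus_one) simp
  then have "1 / 2 \<le> ln (2::real)" by (simp add: ln_div)
  also have "\<dots> \<le> l" unfolding l_def using m by simp
  finally have l: "1 / 2 \<le> l" .
  have J: "4 * G\<^sup>2 < J" "J \<le> 5 * G\<^sup>2" unfolding J_def using pw(4) by linarith+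
  have g: "G + 1 \<le> g" "g \<le> 3 * G" unfolding g_def using G by linarith+
  have \<beta>0: "0 \<le> \<beta>" unfolding \<beta>_def by simp
  have \<beta>G: "\<beta> * G\<^sup>2 = 128 * G ^ 4" unfolding \<beta>_def by simp
  have s1: "1 + 2 * exp (\<beta> * G\<^sup>2) * ln m \<le> s" unfolding s_def l_def by linarith
  have \<epsilon>: "4 * exp (1 - \<beta> / 8) * (G + 1) \<le> \<epsilon>"
  proof -
    have "32 * (G + 1) \<le> 2 ^ 6 * G" using G by simp
    also have "\<dots> \<le> exp 6 * exp G" using two_pow[of 6] GE G by (intro mult_mono) auto
    finally have "32 * (G + 1) * 2 ^ J \<le> exp 6 * exp G * exp (real J)"
      by (rule mult_mono[OF _ two_pow]) auto
    also have "\<dots> = exp (6 + G + J)" by (simp add: exp_add)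
    finally have "32 * (G + 1) * 2 ^ J * exp (1 - \<beta> / 8) \<le> exp (6 + G + J) * exp (1 - \<beta> / 8)"
      by (intro mult_right_mono) auto
    also have "\<dots> = exp (6 + G + J + (1 - \<beta> / 8))" by (simp only: exp_add)
    also have "\<dots> \<le> exp 0" unfolding exp_le_cancel_iff \<beta>_def using J(2) pw by linarith
    finally show ?thesis unfolding \<epsilon>_def by (simp add: field_simps)
  qed
  define r where "r = 3 / (32 * G) * exp (- \<beta> * G\<^sup>2)"
  have \<delta>r: "\<delta> = r ^ J" unfolding \<delta>_def r_def ..
  have "3 / (32 * G) \<le> 1" using G by (simp add: field_simps)
  then have "r \<le> 1 * 1" unfolding r_def using G \<beta>0 by (intro mult_mono) auto
  then have r: "0 < r" "r \<le> 1" unfolding r_def using G by auto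
  then have \<delta>: "0 < \<delta>" "\<delta> \<le> 1" unfolding \<delta>r by (auto intro: power_le_one)
  have peel: "\<exists>R\<subseteq>S. \<delta> * card S \<le> card R \<and> signed_blocky_sum m n (J * (s * (g * 2))) (restrict_rows R A)"
    if S: "S \<subseteq> {..<m}" "S \<noteq> {}" for S
    unfolding \<delta>_def
  proof (rule large_row_set_signed_blocky_sum[OF G v \<beta>0 \<epsilon> g(1) s1 S, where u = u and e = 0 and E = "G\<^sup>2"])
    show "(0 + \<epsilon>) * 2 ^ J \<le> 1 / 8" unfolding \<epsilon>_def by simp
  qed (use S u J A in auto)
  have t: "l / \<delta> < t" "t \<le> l / \<delta> + 2" unfolding t_def using l \<delta> divide_nonneg_pos[of l \<delta>] by linarith+
  have small: "(1 - \<delta>) ^ t * card {..<m} < 1"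
  proof -
    have "(1 - \<delta>) ^ t \<le> exp (- \<delta>) ^ t"
      using \<delta> exp_ge_add_one_self[of "- \<delta>"] by (intro power_mono) auto
    also have "\<dots> = exp (- (\<delta> * t))" by (simp add: exp_of_nat_mult[symmetric] mult.commute)
    also have "\<dots> < exp (- l)" using t(1) \<delta> by (simp add: field_simps)
    also have "\<dots> = 1 / m" unfolding l_def using m by (simp add: exp_minus divide_inverse)
    finally show ?thesis using m by (simp add: field_simps)
  qed
  have "signed_blocky_sum m n (t * (J * (s * (g * 2)))) (restrict_rows {..<m} A)"
    by (rule signed_blocky_sum_peel_rows[OF peel _ \<delta>(2) small]) auto
  then have main: "signed_blocky_sum m n (t * (J * (s * (g * 2)))) A"
    by (rule signed_blocky_sum_cong) (simp add: restrict_rows_def)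
  \<comment> \<open>The exponent \<open>G ^ 6\<close> arises here: a loss of
    \<open>exp (133 * G ^ 4)\<close> in each of at most \<open>5 * G\<^sup>2\<close> rounds.\<close>
  have "1 / r \<le> exp (133 * G ^ 4)"
  proof -
    have "1 / r = 32 * G / 3 * exp (\<beta> * G\<^sup>2)" unfolding r_def using G by (simp add: exp_minus field_simps)
    also have "\<dots> \<le> (2 ^ 4 * G) * exp (128 * G ^ 4)" unfolding \<beta>G using G by (intro mult_right_mono) auto
    also have "\<dots> \<le> (exp 4 * exp G) * exp (128 * G ^ 4)"
      using two_pow[of 4] GE G by (intro mult_right_mono mult_mono) auto
    also have "\<dots> = exp (4 + G + 128 * G ^ 4)" by (simp add: exp_add)
    also have "\<dots> \<le> exp (133 * G ^ 4)" using pw by simp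
    finally show ?thesis .
  qed
  then have "(1 / r) ^ J \<le> exp (133 * G ^ 4) ^ J" using r by (intro power_mono) auto
  also have "\<dots> = exp (J * (133 * G ^ 4))" by (simp add: exp_of_nat_mult)
  also have "\<dots> \<le> exp (5 * G\<^sup>2 * (133 * G ^ 4))"
    unfolding exp_le_cancel_iff using J(2) G by (intro mult_right_mono) auto
  also have "5 * G\<^sup>2 * (133 * G ^ 4) = 665 * Q" unfolding Q_def by (simp add: power_add[symmetric])
  finally have inv_\<delta>: "1 / \<delta> \<le> exp (665 * Q)" unfolding \<delta>r by (simp add: power_divide)
  have exp1: "1 \<le> exp (665 * Q)" "1 \<le> exp (128 * Q)" using pw by auto
  \<comment> \<open>Since \<open>l \<ge> 1 / 2\<close>, the additive constant 2 is absorbed into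
    \<open>4 * l\<close>; the same is done for \<open>s\<close>.\<close>
  have "t \<le> l * (1 / \<delta>) + l * 4 * 1" using t(2) l by simp
  also have "\<dots> \<le> l * exp (665 * Q) + l * 4 * exp (665 * Q)"
    using inv_\<delta> exp1 l by (intro add_mono mult_left_mono) auto
  finally have t': "t \<le> 5 * l * exp (665 * Q)" by simp
  have "s \<le> 2 + 2 * exp (\<beta> * G\<^sup>2) * l" unfolding s_def using l by (simp add: ceiling_le_iff) linarith
  also have "\<dots> \<le> 4 * l * exp (128 * Q) + 2 * exp (128 * Q) * l"
  proof (rule add_mono)
    have "2 \<le> 4 * l * 1" using l by simp
    also have "\<dots> \<le> 4 * l * exp (128 * Q)" using exp1 l by (intro mult_left_mono) auto
    finally show "2 \<le> 4 * l * exp (128 * Q)" .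
    show "2 * exp (\<beta> * G\<^sup>2) * l \<le> 2 * exp (128 * Q) * l"
      unfolding \<beta>G using pw l by (intro mult_right_mono) auto
  qed
  finally have s': "s \<le> 6 * l * exp (128 * Q)" by simp
  \<comment> \<open>The peeling count \<open>t\<close> and the cluster count \<open>s\<close>
    contribute one logarithm each; powers of \<open>G\<close> are absorbed into the
    exponential.\<close>
  have "real (t * (J * (s * (g * 2)))) = real t * (real J * (real s * (real g * 2)))" by simp
  also have "\<dots> \<le> (5 * l * exp (665 * Q)) * (5 * G\<^sup>2 * ((6 * l * exp (128 * Q)) * (3 * G * 2)))"
    using t' J(2) s' g(2) l G by (intro mult_mono) auto
  also have "\<dots> = l\<^sup>2 * (900 * G ^ 3) * (exp (665 * Q) * exp (128 * Q))"
    by (simp add: power2_eq_square power3_eq_cube)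
  also have "\<dots> \<le> l\<^sup>2 * exp (13 * Q) * (exp (665 * Q) * exp (128 * Q))"
  proof (intro mult_right_mono mult_left_mono)
    have "900 * G ^ 3 \<le> 2 ^ 10 * exp G ^ 3" using GE G by (intro mult_mono power_mono) auto
    also have "\<dots> \<le> exp 10 * exp G ^ 3" using two_pow[of 10] by (intro mult_right_mono) auto
    also have "\<dots> = exp (10 + 3 * G)" by (simp add: exp_add exp_of_nat_mult[symmetric])
    also have "\<dots> \<le> exp (13 * Q)" using pw by simp
    finally show "900 * G ^ 3 \<le> exp (13 * Q)" .
  qed auto
  also have "\<dots> = l\<^sup>2 * exp (806 * Q)" by (simp add: mult.assoc exp_add[symmetric])
  also have "\<dots> \<le> l\<^sup>2 * exp (1000 * Q)" using pw by (intro mult_left_mono) auto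
  finally have "real (t * (J * (s * (g * 2)))) \<le> exp (1000 * G ^ 6) * (ln m)\<^sup>2"
    unfolding l_def Q_def by (simp add: mult.commute)
  then show ?thesis using main by blast
qed

text \<open>Rescaling moves the factor \<open>b\<close> from the columns to the rows.\<close>

lemma signed_blocky_sum_of_factorization:
  fixes G :: real
  assumes m: "2 \<le> m" and G: "1 \<le> G" and ab: "0 \<le> a" "0 \<le> b" "a * b \<le> G"
    and u: "\<And>x. x < m \<Longrightarrow> ip d (u x) (u x) \<le> a\<^sup>2"
    and v: "\<And>y. y < n \<Longrightarrow> ip d (v y) (v y) \<le> b\<^sup>2"
    and A: "\<And>x y. x < m \<Longrightarrow> y < n \<Longrightarrow> real_of_int (A x y) = ip d (u x) (v y)"
  shows "\<exists>L. signed_blocky_sum m n L A \<and> real L \<le> exp (1000 * G ^ 6) * (ln m)\<^sup>2"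
proof (rule signed_blocky_sum_of_normalized_factorization[OF m G,
    where u = "\<lambda>x k. b * u x k" and v = "\<lambda>y k. v y k / b" and d = d])
  have uu: "ip d (\<lambda>k. b * u x k) (\<lambda>k. b * u x k) = b\<^sup>2 * ip d (u x) (u x)" for x
    by (simp add: ip_def sum_distrib_left power2_eq_square mult_ac)
  fix x assume x: "x < m"
  have "b\<^sup>2 * ip d (u x) (u x) \<le> b\<^sup>2 * a\<^sup>2" using u[OF x] by (intro mult_left_mono) auto
  also have "\<dots> = (a * b)\<^sup>2" by (simp add: power_mult_distrib)
  also have "\<dots> \<le> G\<^sup>2" using ab by (intro power_mono) auto
  finally show "ip d (\<lambda>k. b * u x k) (\<lambda>k. b * u x k) \<le> G\<^sup>2" unfolding uu .
next
  fix y assume y: "y < n"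
  have vv: "ip d (\<lambda>k. v y k / b) (\<lambda>k. v y k / b) = ip d (v y) (v y) / b\<^sup>2"
    by (simp add: ip_def sum_divide_distrib power2_eq_square)
  show "ip d (\<lambda>k. v y k / b) (\<lambda>k. v y k / b) \<le> 1"
    unfolding vv using v[OF y] by (cases "b = 0") (auto simp: divide_le_eq)
next
  fix x y assume xy: "x < m" "y < n"
  show "real_of_int (A x y) = ip d (\<lambda>k. b * u x k) (\<lambda>k. v y k / b)"
  proof (cases "b = 0")
    \<comment> \<open>Division by zero yields 0, which is harmless: the columns of norm 0 make every
      entry of \<open>A\<close> vanish.\<close>
    case True
    then have "ip d (v y) (v y) = 0" using v[OF xy(2)] ip_self_nonneg[of d "v y"] by simp
    then have "(ip d (u x) (v y))\<^sup>2 \<le> 0" using ip_Cauchy_Schwarz[of d "u x" "v y"] by simp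
    then show ?thesis using A[OF xy] True by (simp add: ip_def)
  next
    case False
    then show ?thesis using A[OF xy] by (simp add: ip_def)
  qed
qed

section \<open>From the infimum to a factorisation, and the final constants\<close>

text \<open>\<open>gamma2\<close> is an infimum, so a strict upper bound \<open>r\<close> yields a
  factorisation below \<open>r\<close> without showing that the minimum is attained. Positive
  \<open>m\<close> and \<open>n\<close> keep the maxima over nonempty sets, hence
  nonnegative.\<close>

lemma gamma2_less_factorization:
  assumes "gamma2 m n A < r" "0 < m" "0 < n"
  shows "\<exists>d U V (a::real) b. (\<forall>x<m. \<forall>y<n. real_of_int (A x y) = ip d (U x) (V y)) \<and>
    (\<forall>x<m. ip d (U x) (U x) \<le> a\<^sup>2) \<and> (\<forall>y<n. ip d (V y) (V y) \<le> b\<^sup>2) \<and>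
    0 \<le> a \<and> 0 \<le> b \<and> a * b < r"
proof -
  define X where "X = {r. \<exists>(d :: nat) (U :: nat \<Rightarrow> nat \<Rightarrow> real) (V :: nat \<Rightarrow> nat \<Rightarrow> real).
       (\<forall>x<m. \<forall>y<n. real_of_int (A x y) = (\<Sum>k<d. U x k * V k y)) \<and>
       r = row_norm m d U * col_norm d n V}"
  \<comment> \<open>The trivial factorisation of \<open>A\<close> as \<open>A\<close> times the
    identity makes the set of products nonempty.\<close>
  have "row_norm m n (\<lambda>x k. real_of_int (A x k)) * col_norm n n (\<lambda>k y. if k = y then 1 else 0) \<in> X"
    unfolding X_def
    by (rule CollectI, rule exI[of _ n], rule exI[of _ "\<lambda>x k. real_of_int (A x k)"],
        rule exI[of _ "\<lambda>k y. if k = y then 1 else 0"])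
       (simp add: if_distrib[of "\<lambda>c. _ * c"] cong: if_cong)
  then have "X \<noteq> {}" by blast
  then obtain c where "c \<in> X" "c < r" using cInf_lessD[of X r] assms(1) unfolding gamma2_def X_def[symmetric] by blast
  then obtain d U V where UV: "\<forall>x<m. \<forall>y<n. real_of_int (A x y) = (\<Sum>k<d. U x k * V k y)"
    and r: "row_norm m d U * col_norm d n V < r" unfolding X_def by blast
  have row: "sqrt (\<Sum>k<d. (U x k)\<^sup>2) \<le> row_norm m d U" if "x < m" for x
    unfolding row_norm_def using that by (intro Max_ge) auto
  have col: "sqrt (\<Sum>k<d. (V k y)\<^sup>2) \<le> col_norm d n V" if "y < n" for y
    unfolding col_norm_def using that by (intro Max_ge) auto
  show ?thesis
  proof (rule exI[of _ d], rule exI[of _ U], rule exI[of _ "\<lambda>y k. V k y"],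
      rule exI[of _ "row_norm m d U"], rule exI[of _ "col_norm d n V"], intro conjI allI impI)
    show "real_of_int (A x y) = ip d (U x) (\<lambda>k. V k y)" if "x < m" "y < n" for x y
      using UV that by (simp add: ip_def)
    show "ip d (U x) (U x) \<le> (row_norm m d U)\<^sup>2" if "x < m" for x
      using sqrt_le_D[OF row[OF that]] by (simp add: ip_def power2_eq_square)
    show "ip d (\<lambda>k. V k y) (\<lambda>k. V k y) \<le> (col_norm d n V)\<^sup>2" if "y < n" for y
      using sqrt_le_D[OF col[OF that]] by (simp add: ip_def power2_eq_square)
    show "0 \<le> row_norm m d U"
      using row[OF assms(2)] by (rule order_trans[rotated]) (simp add: sum_nonneg)
    show "0 \<le> col_norm d n V"
      using col[OF assms(3)] by (rule order_trans[rotated]) (simp add: sum_nonneg)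
  qed (rule r)
qed

theorem theorem1p3:
  shows "\<exists>C>0. \<forall>(m::nat) (n::nat) (A :: nat \<Rightarrow> nat \<Rightarrow> int) (\<gamma>::real).
           min m n \<ge> 2 \<longrightarrow> gamma2 m n A \<le> \<gamma> \<longrightarrow>
           real (block m n A) \<le> 2 powr (C * \<gamma> ^ 7) * (ln (real (min m n)))\<^sup>2"
proof (intro exI[of _ "128000::real"] conjI allI impI)
  fix m n :: nat and A :: "nat \<Rightarrow> nat \<Rightarrow> int" and \<gamma> :: real
  assume mn: "2 \<le> min m n" and \<gamma>: "gamma2 m n A \<le> \<gamma>"
  have m: "2 \<le> m" and n: "2 \<le> n" and mn_pos: "0 < m" "0 < n" using mn by auto
  show "real (block m n A) \<le> 2 powr (128000 * \<gamma> ^ 7) * (ln (real (min m n)))\<^sup>2"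
  proof (cases "\<gamma> < 1")
    \<comment> \<open>All entries are integers of absolute value below 1, so \<open>A\<close>
      vanishes and has block complexity 0; this also covers negative
      \<open>\<gamma>\<close>.\<close>
    case True
    then have "gamma2 m n A < 1" using \<gamma> by simp
    from gamma2_less_factorization[OF this mn_pos] obtain d U V and a b :: real where
      AUV: "\<forall>x<m. \<forall>y<n. real_of_int (A x y) = ip d (U x) (V y)"
        "\<forall>x<m. ip d (U x) (U x) \<le> a\<^sup>2" "\<forall>y<n. ip d (V y) (V y) \<le> b\<^sup>2"
      and ab: "0 \<le> a" "0 \<le> b" "a * b < 1"
      by (elim exE conjE) (rule that; assumption)
    have A: "\<And>x y. x < m \<Longrightarrow> y < n \<Longrightarrow> real_of_int (A x y) = ip d (U x) (V y)"
      and UV: "\<And>x. x < m \<Longrightarrow> ip d (U x) (U x) \<le> a\<^sup>2" "\<And>y. y < n \<Longrightarrow> ip d (V y) (V y) \<le> b\<^sup>2"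
      using AUV by auto
    have "A x y = 0" if xy: "x < m" "y < n" for x y
    proof -
      have "(real_of_int (A x y))\<^sup>2 \<le> ip d (U x) (U x) * ip d (V y) (V y)"
        unfolding A[OF xy] by (rule ip_Cauchy_Schwarz)
      also have "\<dots> \<le> a\<^sup>2 * b\<^sup>2" using UV xy ip_self_nonneg by (intro mult_mono) auto
      also have "\<dots> = (a * b)\<^sup>2" by (simp add: power_mult_distrib)
      also have "\<dots> < 1" using ab by (simp only: abs_square_less_1 abs_of_nonneg mult_nonneg_nonneg)
      finally have "\<bar>real_of_int (A x y)\<bar> < 1" by (simp add: abs_square_less_1)
      then show ?thesis by linarith
    qed
    then have "signed_blocky_sum m n 0 A"
      by (intro signed_blocky_sum_cong[OF signed_blocky_sum_zero]) auto
    then have "block m n A = 0" using block_le by blast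
    then show ?thesis by simp
  next
    case False
    then have \<gamma>1: "1 \<le> \<gamma>" by simp
    \<comment> \<open>Doubling \<open>\<gamma>\<close> gives the strict inequality needed to extract
      a factorisation, at the cost of a constant.\<close>
    then have "gamma2 m n A < 2 * \<gamma>" using \<gamma> by simp
    from gamma2_less_factorization[OF this mn_pos] obtain d U V and a b :: real where
      AUV: "\<forall>x<m. \<forall>y<n. real_of_int (A x y) = ip d (U x) (V y)"
        "\<forall>x<m. ip d (U x) (U x) \<le> a\<^sup>2" "\<forall>y<n. ip d (V y) (V y) \<le> b\<^sup>2"
      and ab: "0 \<le> a" "0 \<le> b" "a * b < 2 * \<gamma>"
      by (elim exE conjE) (rule that; assumption)
    have A: "\<And>x y. x < m \<Longrightarrow> y < n \<Longrightarrow> real_of_int (A x y) = ip d (U x) (V y)"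
      and UV: "\<And>x. x < m \<Longrightarrow> ip d (U x) (U x) \<le> a\<^sup>2" "\<And>y. y < n \<Longrightarrow> ip d (V y) (V y) \<le> b\<^sup>2"
      using AUV by auto
    have G: "1 \<le> 2 * \<gamma>" using \<gamma>1 by simp
    have "\<exists>L. signed_blocky_sum m n L A \<and> real L \<le> exp (1000 * (2 * \<gamma>) ^ 6) * (ln (min m n))\<^sup>2"
    proof (cases "m \<le> n")
      case True
      then show ?thesis
        using signed_blocky_sum_of_factorization[OF m G ab(1,2) _ UV A] ab(3) by (simp add: min_def)
    next
      case False
      \<comment> \<open>With fewer columns than rows, the transpose puts the shorter side in the
        role of the rows, whose number enters the logarithm.\<close>
      have "\<exists>L. signed_blocky_sum n m L (\<lambda>x y. A y x) \<and> real L \<le> exp (1000 * (2 * \<gamma>) ^ 6) * (ln n)\<^sup>2"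
        by (rule signed_blocky_sum_of_factorization[OF n G ab(2,1) _ UV(2,1)])
           (use ab(3) A in \<open>auto simp: mult.commute ip_commute\<close>)
      then obtain L where L: "signed_blocky_sum n m L (\<lambda>x y. A y x)"
        "real L \<le> exp (1000 * (2 * \<gamma>) ^ 6) * (ln n)\<^sup>2" by blast
      then show ?thesis using signed_blocky_sum_transpose[OF L(1)] False by (auto simp: min_def)
    qed
    then obtain L where L: "signed_blocky_sum m n L A"
      "real L \<le> exp (1000 * (2 * \<gamma>) ^ 6) * (ln (min m n))\<^sup>2" by blast
    have bound: "exp (1000 * (2 * \<gamma>) ^ 6) \<le> 2 powr (128000 * \<gamma> ^ 7)"
    proof -
      have "ln (1 / 2) \<le> (1 / 2 - 1 :: real)" by (rule ln_le_minus_one) simp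
      then have ln2: "1 / 2 \<le> ln (2::real)" by (simp add: ln_div)
      \<comment> \<open>\<open>1000 * 2 ^ 6 = 64000\<close>, and \<open>ln 2 \<ge> 1 / 2\<close>
        doubles it when the base changes to 2. The passage to \<open>\<gamma> ^ 7\<close> uses
        \<open>\<gamma> \<ge> 1\<close>.\<close>
      have "1000 * (2 * \<gamma>) ^ 6 = 64000 * \<gamma> ^ 6" by (simp add: power_mult_distrib)
      also have "\<dots> \<le> 64000 * \<gamma> ^ 7" using power_increasing[of 6 7 \<gamma>] \<gamma>1 by simp
      also have "\<dots> = 128000 * \<gamma> ^ 7 * (1 / 2)" by simp
      also have "\<dots> \<le> 128000 * \<gamma> ^ 7 * ln 2" using ln2 \<gamma>1 by (intro mult_left_mono) auto
      finally show ?thesis by (simp add: powr_def)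
    qed
    have "real (block m n A) \<le> real L" using block_le[OF L(1)] by simp
    also note L(2)
    also have "exp (1000 * (2 * \<gamma>) ^ 6) * (ln (min m n))\<^sup>2 \<le> 2 powr (128000 * \<gamma> ^ 7) * (ln (min m n))\<^sup>2"
      using bound by (intro mult_right_mono) auto
    finally show ?thesis .
  qed
qed simp

end
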